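(* Let $\Omega_{\mathbb{N}}=\mathbb{C}\setminus\{-n\colon n\in\mathbb{N}\}$. For every $z\in\Omega_{\mathbb{N}}$ and every $\epsilon>0$, there exist two constants $c_1=c_1(z,\epsilon)\in\mathbb{R}$ and $c_2=c_2(z)>0$ such that $$\frac{1}{4+\epsilon}\log n + c_1 \le d_{\Omega_{\mathbb{N}}}(z,z+n) \le \frac{1}{4}\log n + c_2, \quad \text{for all }n\in\mathbb{N}.$$
   Context: $\mathbb{N}=\{1,2,\dots\}$. A domain $D\subseteq\mathbb{C}$ is hyperbolic if $\mathbb{C}\setminus D$ contains at least two points. Its hyperbolic metric $\lambda_D(z)|dz|$ is determined by $\lambda_D(\pi(z))|\pi'(z)|=\frac{1}{1-|z|^2}$, $z\in\mathbb{D}$, for any holomorphic universal covering $\pi\colon\mathbb{D}\to D$ of $D$ by the unit disc $\mathbb{D}$. The hyperbolic distance is $d_D(z,w)=\inf_\gamma\int_\gamma\lambda_D(\zeta)|d\zeta|$, the infimum being over all piecewise $C^1$ curves in $D$ joining $z$ and $w$. *)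

theory Defs
  imports "HOL-Complex_Analysis.Complex_Analysis"
begin

(* Since the unit disc is simply connected, every covering map from it is a universal covering. *)
definition holomorphic_universal_covering :: "(complex \<Rightarrow> complex) \<Rightarrow> complex set \<Rightarrow> bool" where
  "holomorphic_universal_covering p D \<longleftrightarrow>
     p holomorphic_on ball 0 1 \<and> covering_space (ball 0 1) p D"

(* Meaningful for w in a hyperbolic domain D: by the uniformization theorem a covering p exists,
   and the value does not depend on the choice of p or of the preimage z of w. *)
definition hyperbolic_density :: "complex set \<Rightarrow> complex \<Rightarrow> real" where
  "hyperbolic_density D w =
     (THE l. \<forall>p z. holomorphic_universal_covering p D \<and> z \<in> ball 0 1 \<and> p z = w \<longrightarrow>
        l * norm (deriv p z) = 1 / (1 - (norm z)\<^sup>2))"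

(* Classical piecewise C^1: continuously differentiable on each closed interval of a partition of
   [0,1], with one-sided derivatives at the partition points. This is stronger than valid_path,
   which allows the derivative to be unbounded near the exceptional points and hence admits
   non-rectifiable curves, to which the integral below would assign the value 0. *)
definition piecewise_C1_curve :: "(real \<Rightarrow> complex) \<Rightarrow> bool" where
  "piecewise_C1_curve g \<longleftrightarrow> path g \<and>
     (\<exists>S. finite S \<and> {0, 1} \<subseteq> S \<and> S \<subseteq> {0..1} \<and>
        (\<forall>a\<in>S. \<forall>b\<in>S. a < b \<and> {a<..<b} \<inter> S = {} \<longrightarrow>
           (\<exists>g'. continuous_on {a..b} g' \<and>
              (\<forall>t\<in>{a..b}. (g has_vector_derivative g' t) (at t within {a..b})))))"

(* At the finitely many partition points vector_derivative may be meaningless; this does not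
   affect the integral. *)
definition hyperbolic_length :: "complex set \<Rightarrow> (real \<Rightarrow> complex) \<Rightarrow> real" where
  "hyperbolic_length D g =
     integral {0..1} (\<lambda>t. hyperbolic_density D (g t) *
       norm (vector_derivative g (at t within {0..1})))"

definition hyperbolic_dist :: "complex set \<Rightarrow> complex \<Rightarrow> complex \<Rightarrow> real" where
  "hyperbolic_dist D z w =
     Inf {hyperbolic_length D g | g.
       piecewise_C1_curve g \<and> path_image g \<subseteq> D \<and> pathstart g = z \<and> pathfinish g = w}"

definition Omega_N :: "complex set" where
  "Omega_N = UNIV - {- of_nat n | n :: nat. n \<ge> 1}"

end

theory Submission imports Defs begin

text \<open>On a large scale \<open>Omega_N\<close> looks like the plane slit along the negative real axis. The hyperbolic
density of the slit plane at \<open>w\<close> is at least \<open>1/(4|w|)\<close>, with equality on the positive axis, so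
crossing the annulus between radius \<open>1\<close> and radius \<open>n\<close> costs about \<open>1/4 * ln n\<close>, and moving straight
to the right achieves this.

The comparison rests on the description of the density at \<open>w\<close> as the reciprocal of the largest
\<open>|f'(0)|\<close> among holomorphic maps \<open>f\<close> of the unit disc into the domain with \<open>f 0 = w\<close>
(\<open>hyperbolic_density_le\<close>, \<open>hyperbolic_density_attained\<close>). For the upper bound, a conformal map onto
a slit plane inside \<open>Omega_N\<close> is such an \<open>f\<close> (\<open>hyperbolic_density_Omega_N_le\<close>). For the lower bound,
suppose that maps \<open>f\<^sub>k\<close> with \<open>f\<^sub>k 0\<close> of size about \<open>R\<^sub>k\<close>, where \<open>R\<^sub>k\<close> tends to infinity, had
\<open>|f\<^sub>k'(0)| > (4 + \<epsilon>) R\<^sub>k\<close>. The rescaled maps \<open>f\<^sub>k/R\<^sub>k\<close> form a normal family and omit an ever finer set of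
points on the negative axis; by Hurwitz a limit omits the whole closed negative axis, so that its derivative at
\<open>0\<close> is at most \<open>4\<close>, a contradiction (\<open>Omega_N_asymptotic_Schwarz\<close>). Integrating the resulting lower
bound \<open>1 / ((4 + \<epsilon>) * sqrt (|w|\<^sup>2 + K\<^sup>2))\<close> along a curve gives the left inequality
(\<open>hyperbolic_length_ge\<close>).

The density means something only if \<open>Omega_N\<close> has a holomorphic universal covering by the disc, and
proving this is the larger part of the work. A covering is encoded by local sections (\<open>ball_sections\<close>). If
some open subset of the disc covers a domain \<open>D\<close> that omits two points, then among all such subsets \<open>V\<close>
with a map \<open>q\<close> sending \<open>0\<close> to a base point one takes a sequence along which \<open>|q'(0)|\<close> tends to its
infimum. Koebe's square root step shows that a missing point near \<open>0\<close> would allow \<open>|q'(0)|\<close> to decrease by a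
definite factor, so these subsets exhaust the disc, and a normal family limit is the universal covering
(\<open>universal_covering_exists\<close>). A first pair \<open>V, q\<close> for \<open>Omega_N\<close> comes from complex dynamics. The
linearising coordinate at the attracting fixed point of a quadratic Blaschke product with multiplier \<open>1/2\<close>
is, once normalised, branched only over the points \<open>-(2^k)\<close> with \<open>k \<ge> 1\<close>, all of which are missing from
\<open>Omega_N\<close> (\<open>Koenigs_ball_sections\<close>).\<close>

section \<open>Normal families of functions that omit two values\<close>

text \<open>Applying Schottky's theorem to the dilate \<open>x \<mapsto> f (s * x)\<close> with \<open>s = (1 + t)/2\<close> replaces the closed disc
by the open one; the ratio \<open>t / s = 2 * t / (1 + t)\<close> is still less than \<open>1\<close>.\<close>
lemma Schottky_open_disc:
  assumes holf: "f holomorphic_on ball 0 1" and not01: "\<And>z. z \<in> ball 0 1 \<Longrightarrow> f z \<noteq> 0 \<and> f z \<noteq> 1"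
    and r: "norm (f 0) \<le> r" and t: "0 < t" "t < 1" "norm z \<le> t"
  shows "norm (f z) \<le> exp (pi * exp (pi * (2 + 2 * r + 12 * (2*t/(1+t)) / (1 - 2*t/(1+t)))))"
proof -
  define s where "s = (1 + t) / 2"
  have s: "0 < s" "s < 1" using t by (auto simp: s_def)
  have im: "of_real s * x \<in> ball 0 1" if "x \<in> cball 0 1" for x :: complex
  proof -
    have "s * norm x \<le> s * 1" using that s by (intro mult_left_mono) auto
    then have "s * norm x < 1" using s by linarith
    then show ?thesis using s by (simp add: norm_mult)
  qed
  have "norm (f (of_real s * (z / of_real s))) \<le> exp (pi * exp (pi * (2 + 2 * r + 12 * (t / s) / (1 - t / s))))"
  proof (rule Schottky[where f = "\<lambda>x. f (of_real s * x)"])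
    show "(\<lambda>x. f (of_real s * x)) holomorphic_on cball 0 1"
      by (intro holomorphic_on_compose_gen[of "\<lambda>x. of_real s * x" "cball 0 1" f "ball 0 1", unfolded o_def]
          holomorphic_intros holf) (use im in blast)
    show "norm (z / of_real s) \<le> t / s"
      using t s by (simp add: norm_divide divide_right_mono)
    show "t / s < 1" using t by (simp add: s_def)
  qed (use r t s im not01 in auto)
  moreover have "of_real s * (z / of_real s) = z" using s by simp
  moreover have "t / s = 2 * t / (1 + t)" by (simp add: s_def)
  ultimately show ?thesis by simp
qed

text \<open>Montel's normality test: after the affine normalisation that sends the omitted values to \<open>0\<close> and \<open>1\<close>,
Schottky's theorem gives the local bounds that the elementary Montel theorem asks for.\<close>
lemma Montel_omitting:
  fixes f :: "nat \<Rightarrow> complex \<Rightarrow> complex"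
  assumes holf: "\<And>n. f n holomorphic_on ball 0 1"
    and ab: "a \<noteq> b" "\<And>n z. z \<in> ball 0 1 \<Longrightarrow> f n z \<noteq> a \<and> f n z \<noteq> b"
    and r: "\<And>n. norm (f n 0) \<le> r"
  obtains g k where "g holomorphic_on ball 0 1" "strict_mono (k :: nat \<Rightarrow> nat)"
    "\<And>K. \<lbrakk>compact K; K \<subseteq> ball 0 1\<rbrakk> \<Longrightarrow> uniform_limit K (f \<circ> k) g sequentially"
proof -
  have "\<exists>B. \<forall>h \<in> range f. \<forall>z \<in> K. norm (h z) \<le> B" if K: "compact K" "K \<subseteq> ball 0 1" for K
  proof -
    define r' where "r' = (r + norm a) / norm (b - a)"
    obtain t where t: "0 < t" "t < 1" "K \<subseteq> cball 0 t"
    proof (cases "K = {}")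
      case True then show ?thesis using that[of "1/2"] by auto
    next
      case False
      obtain x where "x \<in> K" "\<And>y. y \<in> K \<Longrightarrow> norm y \<le> norm x"
        using continuous_attains_sup[OF K(1) False, of norm] by (auto intro: continuous_intros)
      then show ?thesis using that[of "max (1/2) (norm x)"] K(2) by (force simp: subset_iff)
    qed
    define M where "M = exp (pi * exp (pi * (2 + 2 * r' + 12 * (2*t/(1+t)) / (1 - 2*t/(1+t)))))"
    have "norm (f n z) \<le> norm a + norm (b - a) * M" if "z \<in> K" for n z
    proof -
      have "norm ((f n z - a) / (b - a)) \<le> M"
        unfolding M_def
      proof (rule Schottky_open_disc[where f = "\<lambda>z. (f n z - a) / (b - a)"])
        show "(\<lambda>z. (f n z - a) / (b - a)) holomorphic_on ball 0 1"
          using ab by (auto intro!: holomorphic_intros holf)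
        have "norm (f n 0 - a) \<le> r + norm a" using r[of n] norm_triangle_ineq4[of "f n 0" a] by linarith
        then show "norm ((f n 0 - a) / (b - a)) \<le> r'"
          by (simp add: r'_def norm_divide divide_right_mono)
        show "\<And>z. z \<in> ball 0 1 \<Longrightarrow> (f n z - a) / (b - a) \<noteq> 0 \<and> (f n z - a) / (b - a) \<noteq> 1"
          using ab by auto
      qed (use t that in auto)
      then have "norm (f n z - a) \<le> norm (b - a) * M"
        using ab by (simp add: norm_divide divide_simps mult.commute)
      then show ?thesis using norm_triangle_ineq2[of "f n z" a] by linarith
    qed
    then show ?thesis by auto
  qed
  note bd = this
  have hol: "h holomorphic_on ball 0 1" if "h \<in> range f" for h
    using that holf by auto
  show ?thesis
    by (rule Montel[OF open_ball hol bd order_refl]) (assumption | rule that)+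
qed

text \<open>Convergence along a moving point. It is used for inverse branches, which are known only at the varying
images of a fixed point.\<close>
lemma uniform_limit_along:
  fixes F :: "nat \<Rightarrow> complex \<Rightarrow> complex"
  assumes "open S" "x \<in> S" and cont: "continuous_on S g"
    and ul: "\<And>K. \<lbrakk>compact K; K \<subseteq> S\<rbrakk> \<Longrightarrow> uniform_limit K F g sequentially"
    and xn: "xn \<longlonglongrightarrow> x"
  shows "(\<lambda>n. F n (xn n)) \<longlonglongrightarrow> g x"
proof -
  obtain e where e: "e > 0" "cball x e \<subseteq> S"
    using assms(1,2) open_contains_cball by blast
  have near: "\<forall>\<^sub>F n in sequentially. xn n \<in> cball x e"
    using tendstoD[OF xn e(1)] by eventually_elim (simp add: dist_commute)
  have "uniform_limit (cball x e) F g sequentially" using ul e by simp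
  then have "(\<lambda>n. F n (xn n) - g (xn n)) \<longlonglongrightarrow> 0"
  proof (intro tendstoI)
    fix d :: real assume "d > 0"
    have "\<forall>\<^sub>F n in sequentially. \<forall>y\<in>cball x e. dist (F n y) (g y) < d"
      using uniform_limitD[OF \<open>uniform_limit (cball x e) F g sequentially\<close> \<open>d > 0\<close>] .
    with near show "\<forall>\<^sub>F n in sequentially. dist (F n (xn n) - g (xn n)) 0 < d"
      by eventually_elim (auto simp: dist_norm)
  qed
  moreover have "(\<lambda>n. g (xn n)) \<longlonglongrightarrow> g x"
    using continuous_on_eq_continuous_at[OF assms(1)] cont xn assms(2) isCont_tendsto_compose by blast
  ultimately show ?thesis using tendsto_add by fastforce
qed

lemma uniform_limit_deriv:
  fixes F :: "nat \<Rightarrow> complex \<Rightarrow> complex"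
  assumes "open S" "x \<in> S" "\<And>n. F n holomorphic_on S"
    and ul: "\<And>K. \<lbrakk>compact K; K \<subseteq> S\<rbrakk> \<Longrightarrow> uniform_limit K F g sequentially"
  shows "(\<lambda>n. deriv (F n) x) \<longlonglongrightarrow> deriv g x"
proof -
  obtain e where e: "e > 0" "cball x e \<subseteq> S"
    using assms(1,2) open_contains_cball by blast
  have "((\<lambda>n. (deriv ^^ 1) (F n) x) \<longlongrightarrow> (deriv ^^ 1) g x) sequentially"
  proof (rule higher_deriv_complex_uniform_limit[where A = "ball x e"])
    show "uniform_limit (ball x e) F g sequentially"
      using uniform_limit_on_subset[OF ul[OF compact_cball e(2)] ball_subset_cball] .
    show "\<forall>\<^sub>F n in sequentially. F n holomorphic_on ball x e"
      using assms(3) e ball_subset_cball by (blast intro: always_eventually holomorphic_on_subset)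
  qed (use e in auto)
  then show ?thesis by simp
qed

section \<open>Coverings described by sections over balls\<close>

text \<open>The covering property in the form in which it survives square root lifts and normal family limits: every
point of \<open>V\<close> over a ball of \<open>D\<close> lies on a sheet over the whole ball. Neither connectedness of \<open>V\<close> nor
surjectivity is part of the notion, so that it passes to preimages of subdomains.\<close>
definition ball_sections :: "complex set \<Rightarrow> (complex \<Rightarrow> complex) \<Rightarrow> complex set \<Rightarrow> bool" where
  "ball_sections V q D \<longleftrightarrow> q holomorphic_on V \<and> q ` V \<subseteq> D \<and>
     (\<forall>c r z. ball c r \<subseteq> D \<and> z \<in> V \<and> q z \<in> ball c r \<longrightarrow>
        (\<exists>g. g holomorphic_on ball c r \<and> g ` ball c r \<subseteq> V \<and>
             (\<forall>w\<in>ball c r. q (g w) = w) \<and> g (q z) = z))"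

lemma ball_sectionsD:
  assumes "ball_sections V q D" "ball c r \<subseteq> D" "z \<in> V" "q z \<in> ball c r"
  obtains g where "g holomorphic_on ball c r" "g ` ball c r \<subseteq> V"
             "\<And>w. w \<in> ball c r \<Longrightarrow> q (g w) = w" "g (q z) = z"
  using assms unfolding ball_sections_def by metis

text \<open>Near a common value both sections invert the injective restriction of \<open>q\<close> to the open image of the first
one, so they agree on an open set, and the identity theorem does the rest.\<close>
lemma sections_agree:
  assumes B: "open B" "connected B"
    and g1: "g1 holomorphic_on B" "\<And>w. w \<in> B \<Longrightarrow> q (g1 w) = w"
    and g2: "g2 holomorphic_on B" "\<And>w. w \<in> B \<Longrightarrow> q (g2 w) = w"
    and b: "b \<in> B" "g1 b = g2 b" and w: "w \<in> B"
  shows "g1 w = g2 w"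
proof -
  have inj: "inj_on g1 B" using g1(2) by (metis inj_onI)
  have opn: "open (g1 ` B)" using open_mapping_thm3[OF g1(1) B(1) inj] .
  define N where "N = B \<inter> g2 -` (g1 ` B)"
  have N: "open N" unfolding N_def
    using continuous_open_preimage[OF holomorphic_on_imp_continuous_on[OF g2(1)] B(1) opn] .
  have bN: "b \<in> N" using b(1) b(2)[symmetric] by (auto simp: N_def)
  have "g1 w = g2 w" if "w \<in> N" for w
    using that g1(2) g2(2) by (auto simp: N_def image_iff) metis
  then show ?thesis
    using analytic_continuation_open[OF N B(1) _ B(2) _ g1(1) g2(1)] bN w N_def by blast
qed

text \<open>The sheets over a ball are the images of all sections over it; they are disjoint because two sections with a
common value coincide. The image is open and relatively closed in \<open>D\<close>: a ball that meets it is contained in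
it.\<close>
lemma covering_space_if_ball_sections:
  assumes sec: "ball_sections V p D" and D: "open D" "connected D" and V: "open V" "V \<noteq> {}"
  shows "covering_space V p D"
proof
  have pV: "p ` V \<subseteq> D" and hol: "p holomorphic_on V" using sec by (auto simp: ball_sections_def)
  show cont: "continuous_on V p" using hol by (rule holomorphic_on_imp_continuous_on)
  have nbhd: "ball c r \<subseteq> p ` V" if "ball c r \<subseteq> D" "z \<in> V" "p z \<in> ball c r" for c r z
    using ball_sectionsD[OF sec that] by (metis image_eqI image_subset_iff subsetI)
  show "p ` V = D"
  proof (rule ccontr)
    assume "p ` V \<noteq> D"
    have "open (p ` V)"
    proof (rule openI)
      fix w assume "w \<in> p ` V"
      then obtain z e where z: "z \<in> V" "w = p z" "e > 0" "ball w e \<subseteq> D"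
        using pV D(1) openE by (metis imageE image_subset_iff)
      then show "\<exists>e>0. ball w e \<subseteq> p ` V"
        using nbhd[of w e z] by auto
    qed
    moreover have "open (D - p ` V)"
    proof (rule openI)
      fix w assume w: "w \<in> D - p ` V"
      then obtain e where e: "e > 0" "ball w e \<subseteq> D" using D(1) openE by (metis DiffD1)
      have "ball w e \<inter> p ` V = {}"
      proof (rule ccontr)
        assume "ball w e \<inter> p ` V \<noteq> {}"
        then obtain z where "z \<in> V" "p z \<in> ball w e" by blast
        then have "ball w e \<subseteq> p ` V" using nbhd e by blast
        then show False using w e(1) centre_in_ball by blast
      qed
      then show "\<exists>e>0. ball w e \<subseteq> D - p ` V" using e by blast
    qed
    ultimately show False
      using connectedD[OF D(2), of "p ` V" "D - p ` V"] V(2) pV \<open>p ` V \<noteq> D\<close> by blast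
  qed
  fix x assume "x \<in> D"
  then obtain e where e: "e > 0" "ball x e \<subseteq> D" using D(1) openE by blast
  define G where "G = {g. g holomorphic_on ball x e \<and> g ` ball x e \<subseteq> V \<and> (\<forall>w\<in>ball x e. p (g w) = w)}"
  have G: "g holomorphic_on ball x e" "g ` ball x e \<subseteq> V" "w \<in> ball x e \<Longrightarrow> p (g w) = w" if "g \<in> G" for g w
    using that by (auto simp: G_def)
  define v where "v = (\<lambda>g. g ` ball x e) ` G"
  have "\<Union>v = V \<inter> p -` ball x e"
  proof
    show "\<Union>v \<subseteq> V \<inter> p -` ball x e" unfolding v_def using G(2,3) by fastforce
    show "V \<inter> p -` ball x e \<subseteq> \<Union>v"
    proof
      fix z assume z: "z \<in> V \<inter> p -` ball x e"
      then obtain g where "g holomorphic_on ball x e" "g ` ball x e \<subseteq> V"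
             "\<And>w. w \<in> ball x e \<Longrightarrow> p (g w) = w" "g (p z) = z"
        using ball_sectionsD[OF sec e(2), of z] by blast
      then have "g \<in> G" "g (p z) = z" by (simp_all add: G_def)
      then show "z \<in> \<Union>v" using z unfolding v_def by (metis Int_iff UN_I image_eqI vimageE)
    qed
  qed
  moreover have "openin (top_of_set V) u" if u: "u \<in> v" for u
  proof -
    obtain g where g: "g \<in> G" "u = g ` ball x e" using u unfolding v_def by blast
    have "inj_on g (ball x e)" using G(3)[OF g(1)] by (intro inj_on_inverseI[of _ p])
    then have "open u" using g(2) open_mapping_thm3[OF G(1)[OF g(1)]] by simp
    then show ?thesis using g G(2) V(1) by (simp add: openin_open_eq)
  qed
  moreover have "pairwise disjnt v"
  proof (rule pairwiseI)
    fix u1 u2 assume u: "u1 \<in> v" "u2 \<in> v" "u1 \<noteq> u2"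
    obtain g1 g2 where g: "g1 \<in> G" "g2 \<in> G" "u1 = g1 ` ball x e" "u2 = g2 ` ball x e"
      using u unfolding v_def by blast
    show "disjnt u1 u2"
    proof (rule ccontr)
      assume "\<not> disjnt u1 u2"
      then obtain w1 w2 where w: "w1 \<in> ball x e" "w2 \<in> ball x e" "g1 w1 = g2 w2"
        unfolding g disjnt_def by blast
      then have "w1 = w2" using G(3)[OF g(1)] G(3)[OF g(2)] by metis
      then have "g1 w = g2 w" if "w \<in> ball x e" for w
        using sections_agree[OF open_ball connected_ball G(1)[OF g(1)] G(3)[OF g(1)] G(1)[OF g(2)] G(3)[OF g(2)] w(1)]
          w that by blast
      then have "u1 = u2" unfolding g by (intro image_cong) auto
      then show False using u by blast
    qed
  qed
  moreover have "\<exists>q. homeomorphism u (ball x e) p q" if u: "u \<in> v" for u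
  proof -
    obtain g where g: "g \<in> G" "u = g ` ball x e" using u unfolding v_def by blast
    have "homeomorphism u (ball x e) p g"
    proof (rule homeomorphismI)
      show "continuous_on u p" using cont G(2)[OF g(1)] g(2) continuous_on_subset by blast
      show "continuous_on (ball x e) g" using G(1)[OF g(1)] holomorphic_on_imp_continuous_on by blast
    qed (use G(3)[OF g(1)] in \<open>auto simp: g(2)\<close>)
    then show ?thesis by blast
  qed
  moreover have "x \<in> ball x e" "openin (top_of_set D) (ball x e)"
    using e D(1) by (simp_all add: openin_open_eq)
  ultimately show "\<exists>T. x \<in> T \<and> openin (top_of_set D) T \<and> (\<exists>v. \<Union>v = V \<inter> p -` T \<and>
      (\<forall>u \<in> v. openin (top_of_set V) u) \<and> pairwise disjnt v \<and> (\<forall>u \<in> v. \<exists>q. homeomorphism u T p q))"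
    by meson
qed

lemma Moebius_deriv_0:
  assumes "norm w < 1"
  shows "(Moebius_function 0 w has_field_derivative (1 - (norm w)\<^sup>2)) (at 0)"
proof -
  have "((\<lambda>z. (z - w) / (1 - cnj w * z)) has_field_derivative
          ((1 - 0) * (1 - cnj w * 0) - (0 - w) * (0 - cnj w * 1)) / ((1 - cnj w * 0) * (1 - cnj w * 0))) (at 0)"
    by (intro derivative_intros) (auto intro!: derivative_eq_intros)
  moreover have "w * cnj w = of_real ((norm w)\<^sup>2)"
    by (simp add: complex_norm_square del: of_real_power)
  ultimately show ?thesis
    by (simp add: Moebius_function_def[abs_def])
qed

lemma Moebius_deriv_centre:
  assumes "norm w < 1"
  shows "(Moebius_function 0 w has_field_derivative (1 / (1 - (norm w)\<^sup>2))) (at w)"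
proof -
  have n: "(norm w)\<^sup>2 < 1" using assms by (simp add: power_less_one_iff abs_square_less_1)
  have e: "w * cnj w = of_real ((norm w)\<^sup>2)"
    by (simp add: complex_norm_square del: of_real_power)
  have ne: "1 - cnj w * w \<noteq> 0"
    using n e by (metis mult.commute of_real_1 of_real_eq_iff eq_iff_diff_eq_0 less_irrefl)
  have "((\<lambda>z. (z - w) / (1 - cnj w * z)) has_field_derivative
          ((1 - 0) * (1 - cnj w * w) - (w - w) * (0 - cnj w * 1)) / ((1 - cnj w * w) * (1 - cnj w * w))) (at w)"
    by (intro derivative_intros) (use ne in \<open>auto intro!: derivative_eq_intros\<close>)
  then show ?thesis
    using ne e by (simp add: Moebius_function_def[abs_def] mult.commute)
qed

lemma ball_sections_subset:
  assumes "ball_sections V q D" "D' \<subseteq> D"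
  shows "ball_sections (V \<inter> q -` D') q D'"
  unfolding ball_sections_def
proof (intro conjI allI impI)
  show "q holomorphic_on V \<inter> q -` D'"
    using assms unfolding ball_sections_def by (blast intro: holomorphic_on_subset)
  fix c r z assume *: "ball c r \<subseteq> D' \<and> z \<in> V \<inter> q -` D' \<and> q z \<in> ball c r"
  obtain g where g: "g holomorphic_on ball c r" "g ` ball c r \<subseteq> V"
             "\<And>w. w \<in> ball c r \<Longrightarrow> q (g w) = w" "g (q z) = z"
    using ball_sectionsD[OF assms(1), of c r z] assms(2) * by blast
  have "g ` ball c r \<subseteq> V \<inter> q -` D'" using g(2,3) * by fastforce
  with g show "\<exists>g. g holomorphic_on ball c r \<and> g ` ball c r \<subseteq> V \<inter> q -` D' \<and>
             (\<forall>w\<in>ball c r. q (g w) = w) \<and> g (q z) = z" by blast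
qed blast

text \<open>An inverse branch on the ball takes values in the unit disc, so Cauchy's estimate bounds its derivative,
which is the reciprocal of that of \<open>q\<close>.\<close>
lemma ball_sections_deriv_bound:
  assumes sec: "ball_sections V q D" and V: "open V" "V \<subseteq> ball 0 1" "z \<in> V" and r: "0 < r" "ball (q z) r \<subseteq> D"
  shows "r / 2 \<le> norm (deriv q z)"
proof -
  obtain g where g: "g holomorphic_on ball (q z) r" "g ` ball (q z) r \<subseteq> V"
      "\<And>w. w \<in> ball (q z) r \<Longrightarrow> q (g w) = w" "g (q z) = z"
    using ball_sectionsD[OF sec r(2) V(3)] r(1) by auto
  have hol: "q holomorphic_on V" using sec by (simp add: ball_sections_def)
  have dg: "(g has_field_derivative deriv g (q z)) (at (q z))"
    using g(1) r(1) by (intro holomorphic_derivI[of _ "ball (q z) r"]) auto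
  have dq: "(q has_field_derivative deriv q z) (at (g (q z)))"
    using hol V(1,3) g(4) by (auto intro: holomorphic_derivI)
  have "((\<lambda>w. q (g w)) has_field_derivative deriv q z * deriv g (q z)) (at (q z))"
    using DERIV_chain[OF dq dg] by (simp add: o_def)
  moreover have "((\<lambda>w. q (g w)) has_field_derivative 1) (at (q z))"
    using has_field_derivative_transform_within_open[of "\<lambda>w. w" 1 "q z" "ball (q z) r" "\<lambda>w. q (g w)"] g(3) r(1)
    by auto
  ultimately have one: "deriv q z * deriv g (q z) = 1" using DERIV_unique by blast
  have "norm ((deriv ^^ 1) g (q z)) \<le> fact 1 * 1 / (r / 2) ^ 1"
  proof (rule Cauchy_inequality)
    show "g holomorphic_on ball (q z) (r/2)" using g(1) by (rule holomorphic_on_subset) (use r in auto)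
    show "continuous_on (cball (q z) (r/2)) g"
      using holomorphic_on_imp_continuous_on[OF g(1)] by (rule continuous_on_subset) (use r in auto)
    show "norm (g x) \<le> 1" if "norm (q z - x) = r/2" for x
    proof -
      have "x \<in> ball (q z) r" using that r(1) by (simp add: dist_norm)
      then have "g x \<in> ball 0 1" using g(2) V(2) by blast
      then show ?thesis by simp
    qed
  qed (use r in auto)
  then have b: "norm (deriv g (q z)) \<le> 2 / r" by simp
  have "1 = norm (deriv q z) * norm (deriv g (q z))" using one by (metis norm_mult norm_one)
  also have "\<dots> \<le> norm (deriv q z) * (2 / r)" using b by (intro mult_left_mono) auto
  finally show ?thesis using r(1) by (simp add: field_simps)
qed

section \<open>Existence of the universal covering\<close>

text \<open>Koebe's osculation step. Let \<open>h\<close> be the proper self-map of the disc of degree two that is branched exactly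
over \<open>a\<close> and fixes \<open>0\<close>. As \<open>a\<close> is not in \<open>V\<close>, the inverse branches into \<open>V\<close> lift through \<open>h\<close> to
\<open>h -` V\<close>, and the chain rule multiplies the derivative at \<open>0\<close> by \<open>|h'(0)| < 1\<close>.\<close>
lemma Koebe_square_root_step:
  assumes sec: "ball_sections V q D" and V: "open V" "V \<subseteq> ball 0 1" "0 \<in> V"
    and a: "a \<in> ball 0 1" "a \<notin> V"
  obtains V' q' where "ball_sections V' q' D" "open V'" "V' \<subseteq> ball 0 1" "0 \<in> V'" "q' 0 = q 0"
    "norm (deriv q' 0) = norm (deriv q 0) * (2 * sqrt (norm a) / (1 + norm a))"
proof -
  \<comment> \<open>\<open>T (-b)\<close> moves \<open>0\<close> to \<open>b\<close>, whose square \<open>- a\<close> is moved back to \<open>0\<close> by \<open>T (-a)\<close>.\<close>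
  define b where "b = csqrt (- a)"
  have b2: "b\<^sup>2 = - a" by (simp add: b_def)
  have nb: "norm b = sqrt (norm a)" using b2 by (metis norm_minus_cancel norm_power norm_ge_zero real_sqrt_unique)
  have na: "norm a < 1" using a by simp
  have nb1: "norm b < 1" using nb na by simp
  have a1: "norm (-a) < 1" and b1: "norm (-b) < 1" using na nb1 by auto
  define T where "T = Moebius_function 0"
  have Tlt: "norm (T w z) < 1" if "norm w < 1" "norm z < 1" for w z
    using that by (simp add: T_def Moebius_function_norm_lt_1)
  have Tinv: "T w (T (-w) z) = z" "T (-w) (T w z) = z" if "norm w < 1" "norm z < 1" for w z
    using that by (simp_all add: T_def Moebius_function_compose)
  have Thol: "T w holomorphic_on ball 0 1" if "norm w < 1" for w
    using that by (simp add: T_def Moebius_function_holomorphic)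
  have T0: "T w 0 = - w" "T w w = 0" for w by (simp_all add: T_def Moebius_function_simple)
  have Tz: "T w z \<noteq> 0" if "norm w < 1" "norm z < 1" "z \<noteq> w" for w z
    using Tinv(2)[OF that(1,2)] that(3) T0(1)[of "-w"] by auto
  define h where "h z = T (-a) ((T (-b) z)\<^sup>2)" for z
  have sq: "norm ((T (-b) z)\<^sup>2) < 1" if "norm z < 1" for z
    using Tlt[OF b1 that] by (simp add: norm_power power_less_one_iff)
  have hlt: "norm (h z) < 1" if "norm z < 1" for z
    unfolding h_def using Tlt[OF a1 sq[OF that]] .
  have hhol: "h holomorphic_on ball 0 1"
  proof -
    have "(\<lambda>z. (T (-b) z)\<^sup>2) holomorphic_on ball 0 1"
      by (intro holomorphic_intros Thol b1)
    moreover have "(\<lambda>z. (T (-b) z)\<^sup>2) ` ball 0 1 \<subseteq> ball 0 1" using sq by auto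
    ultimately show ?thesis
      unfolding h_def using holomorphic_on_compose_gen[OF _ Thol[OF a1]] by (simp add: o_def)
  qed
  have h0: "h 0 = 0" by (simp add: h_def T0 b2)
  have dh: "(h has_field_derivative (1 / (1 - (norm a)\<^sup>2)) * (2 * b * (1 - (norm b)\<^sup>2))) (at 0)"
  proof -
    have 1: "(T (-b) has_field_derivative (1 - (norm b)\<^sup>2)) (at 0)"
      using Moebius_deriv_0[OF b1] by (simp add: T_def)
    have 2: "((\<lambda>z. (T (-b) z)\<^sup>2) has_field_derivative (2 * b * (1 - (norm b)\<^sup>2))) (at 0)"
      using DERIV_power[OF 1, of 2] by (simp add: T0 mult_ac)
    have 3: "(T (-a) has_field_derivative (1 / (1 - (norm a)\<^sup>2))) (at ((T (-b) 0)\<^sup>2))"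
      using Moebius_deriv_centre[OF a1] by (simp add: T_def[symmetric] T0 b2)
    show ?thesis using DERIV_chain[OF 3 2] by (simp add: h_def[abs_def] o_def)
  qed
  define V' where "V' = ball 0 1 \<inter> h -` V"
  define q' where "q' = q \<circ> h"
  have qhol: "q holomorphic_on V" using sec by (simp add: ball_sections_def)
  show ?thesis
  proof
    show "open V'" unfolding V'_def
      using continuous_open_preimage[OF holomorphic_on_imp_continuous_on[OF hhol] _ V(1)] by simp
    show "V' \<subseteq> ball 0 1" "0 \<in> V'" "q' 0 = q 0"
      using V(3) by (auto simp: V'_def h0 q'_def)
    have "(q has_field_derivative deriv q 0) (at (h 0))"
      using qhol V(1,3) h0 by (auto intro: holomorphic_derivI)
    from DERIV_chain[OF this dh]
    have "deriv q' 0 = deriv q 0 * ((1 / (1 - (norm a)\<^sup>2)) * (2 * b * (1 - (norm b)\<^sup>2)))"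
      unfolding q'_def by (rule DERIV_imp_deriv)
    then have "norm (deriv q' 0) = norm (deriv q 0) * ((1 / \<bar>1 - (norm a)\<^sup>2\<bar>) * (2 * norm b * \<bar>1 - (norm b)\<^sup>2\<bar>))"
      by (simp only: norm_mult norm_of_real abs_divide abs_one) simp
    moreover have "(1 / \<bar>1 - (norm a)\<^sup>2\<bar>) * (2 * norm b * \<bar>1 - (norm b)\<^sup>2\<bar>) = 2 * sqrt (norm a) / (1 + norm a)"
    proof -
      have "(norm b)\<^sup>2 = norm a" using nb by simp
      moreover have "1 - (norm a)\<^sup>2 = (1 - norm a) * (1 + norm a)" by (simp add: power2_eq_square algebra_simps)
      moreover have "1 - norm a > 0" "1 + norm a > 0" using na by (auto intro: add_pos_nonneg)
      ultimately show ?thesis by (simp add: nb abs_mult)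
    qed
    ultimately show "norm (deriv q' 0) = norm (deriv q 0) * (2 * sqrt (norm a) / (1 + norm a))" by metis
    show "ball_sections V' q' D"
      unfolding ball_sections_def
    proof (intro conjI allI impI)
      show "q' holomorphic_on V'"
        unfolding q'_def using V'_def
        by (intro holomorphic_on_compose_gen[OF _ qhol] holomorphic_on_subset[OF hhol]) auto
      show "q' ` V' \<subseteq> D" using sec by (auto simp: ball_sections_def V'_def q'_def)
      fix c r z assume *: "ball c r \<subseteq> D \<and> z \<in> V' \<and> q' z \<in> ball c r"
      then have z: "norm z < 1" "h z \<in> V" "q (h z) \<in> ball c r" by (auto simp: V'_def q'_def)
      obtain g where g: "g holomorphic_on ball c r" "g ` ball c r \<subseteq> V"
             "\<And>w. w \<in> ball c r \<Longrightarrow> q (g w) = w" "g (q (h z)) = h z"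
        using ball_sectionsD[OF sec _ z(2,3)] * by blast
      have gV: "g w \<in> V" "norm (g w) < 1" "g w \<noteq> a" if "w \<in> ball c r" for w
      proof -
        show "g w \<in> V" using that g(2) by blast
        then show "norm (g w) < 1" "g w \<noteq> a" using V(2) a(2) by auto
      qed
      have hol: "(\<lambda>w. T a (g w)) holomorphic_on ball c r"
        using holomorphic_on_compose_gen[OF g(1) Thol[OF na]] gV by (simp add: o_def image_subset_iff)
      obtain s0 where s0: "s0 holomorphic_on ball c r" "\<And>w. w \<in> ball c r \<Longrightarrow> T a (g w) = (s0 w)\<^sup>2"
      proof (rule contractible_imp_holomorphic_sqrt[OF hol])
        show "contractible (ball c r)" by (simp add: convex_imp_contractible)
        show "T a (g w) \<noteq> 0" if "w \<in> ball c r" for w using Tz[OF na gV(2,3)[OF that]] .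
      qed blast
      define w0 where "w0 = q (h z)"
      have w0: "w0 \<in> ball c r" using z by (simp add: w0_def)
      have "T a (g w0) = (T (-b) z)\<^sup>2"
        using Tinv(1)[OF na sq[OF z(1)]] by (simp add: w0_def g(4)) (simp add: h_def)
      then have "(s0 w0)\<^sup>2 = (T (-b) z)\<^sup>2" using s0(2)[OF w0] by simp
      then have sg: "s0 w0 = T (-b) z \<or> s0 w0 = - T (-b) z" by (simp add: power2_eq_iff)
      obtain s where s: "s holomorphic_on ball c r" "\<And>w. w \<in> ball c r \<Longrightarrow> T a (g w) = (s w)\<^sup>2"
         "s w0 = T (-b) z"
      proof (cases "s0 w0 = T (-b) z")
        case True then show ?thesis using that[of s0] s0 by blast
      next
        case False
        then show ?thesis using that[of "\<lambda>w. - s0 w"] s0 sg by (auto intro!: holomorphic_intros)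
      qed
      have ns: "norm (s w) < 1" if "w \<in> ball c r" for w
      proof -
        have "norm (s w)^2 < 1"
          using Tlt[OF na gV(2)[OF that]] s(2)[OF that] by (simp add: norm_power)
        then show ?thesis by (simp add: abs_square_less_1)
      qed
      define g' where "g' w = T b (s w)" for w
      have hg': "h (g' w) = g w" if "w \<in> ball c r" for w
        using Tinv(2)[OF nb1 ns[OF that]] s(2)[OF that] Tinv(2)[OF na gV(2)[OF that]]
        by (simp add: h_def g'_def)
      show "\<exists>g. g holomorphic_on ball c r \<and> g ` ball c r \<subseteq> V' \<and>
             (\<forall>w\<in>ball c r. q' (g w) = w) \<and> g (q' z) = z"
      proof (intro exI[of _ g'] conjI ballI)
        show "g' holomorphic_on ball c r"
          unfolding g'_def using holomorphic_on_compose_gen[OF s(1) Thol[OF nb1]] ns by (simp add: o_def image_subset_iff)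
        show "g' ` ball c r \<subseteq> V'"
          using hg' gV(1) Tlt[OF nb1 ns] by (auto simp: V'_def g'_def)
        show "q' (g' w) = w" if "w \<in> ball c r" for w using hg'[OF that] g(3)[OF that] by (simp add: q'_def)
        show "g' (q' z) = z"
          using Tinv(1)[OF nb1 z(1)] s(3) by (simp add: q'_def w0_def[symmetric] g'_def)
      qed
    qed
  qed
qed

text \<open>If the sets \<open>V n\<close> exhaust the disc, the rescaled maps \<open>z \<mapsto> q n (\<rho> n * z)\<close> form a normal family, because
they omit two values and agree at \<open>0\<close>. By the bound \<open>m\<close> a limit \<open>p\<close> is not constant, so Hurwitz's theorem
keeps its values in \<open>D\<close>. The inverse branches are bounded by \<open>1\<close>, hence normal too, and their limits are the
sections of \<open>p\<close>.\<close>
lemma ball_sections_limit: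
  fixes V :: "nat \<Rightarrow> complex set" and q :: "nat \<Rightarrow> complex \<Rightarrow> complex"
  assumes sec: "\<And>n. ball_sections (V n) (q n) D" and V: "\<And>n. V n \<subseteq> ball 0 1"
    and rV: "\<And>n. ball 0 (\<rho> n) \<subseteq> V n" and \<rho>: "\<And>n. 0 < \<rho> n" "\<And>n. \<rho> n < 1" "\<rho> \<longlonglongrightarrow> 1"
    and q0: "\<And>n. q n 0 = w0" and m: "m > 0" "\<And>n. m \<le> norm (deriv (q n) 0)"
    and ab: "a \<noteq> b" "a \<notin> D" "b \<notin> D"
  obtains p where "ball_sections (ball 0 1) p D" "p 0 = w0"
proof -
  define P where "P n z = q n (of_real (\<rho> n) * z)" for n z
  have inV: "of_real (\<rho> n) * z \<in> V n" if "norm z < 1" for n z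
  proof -
    have "\<rho> n * norm z < \<rho> n * 1" using that \<rho>(1)[of n] by (intro mult_strict_left_mono)
    then show ?thesis using rV[of n] \<rho>(1)[of n] by (auto simp: norm_mult subset_iff)
  qed
  have qhol: "q n holomorphic_on V n" and qD: "q n ` V n \<subseteq> D" for n
    using sec[of n] by (auto simp: ball_sections_def)
  have PD: "P n z \<in> D" if "norm z < 1" for n z
    using inV[OF that] qD by (auto simp: P_def)
  have Phol: "P n holomorphic_on ball 0 1" for n
    unfolding P_def[abs_def]
    by (intro holomorphic_on_compose_gen[of "\<lambda>x. of_real (\<rho> n) * x" _ "q n" "V n", unfolded o_def]
          holomorphic_intros qhol) (use inV in auto)
  have P0: "P n 0 = w0" for n by (simp add: P_def q0)
  obtain p k where p: "p holomorphic_on ball 0 1" and k: "strict_mono (k :: nat \<Rightarrow> nat)"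
    and lim: "\<And>K. \<lbrakk>compact K; K \<subseteq> ball 0 1\<rbrakk> \<Longrightarrow> uniform_limit K (P \<circ> k) p sequentially"
  proof (rule Montel_omitting[of P a b "norm w0"])
    show "P n z \<noteq> a \<and> P n z \<noteq> b" if "z \<in> ball 0 1" for n z using PD[of z n] that ab by auto
  qed (use Phol ab P0 in auto)
  have pc: "continuous_on (ball 0 1) p" using p by (rule holomorphic_on_imp_continuous_on)
  have ptw: "(\<lambda>n. P (k n) (x n)) \<longlonglongrightarrow> p y" if "x \<longlonglongrightarrow> y" "norm y < 1" for x y
    using uniform_limit_along[OF open_ball _ pc lim that(1)] that(2) by (simp add: o_def)
  have \<rho>k: "(\<lambda>n. \<rho> (k n)) \<longlonglongrightarrow> 1" using LIMSEQ_subseq_LIMSEQ[OF \<rho>(3) k] by (simp add: o_def)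
  have p0: "p 0 = w0" using ptw[of "\<lambda>_. 0" 0] by (simp add: P0 LIMSEQ_const_iff)
  have dP: "norm (deriv (P n) 0) = \<rho> n * norm (deriv (q n) 0)" for n
  proof -
    have 0: "ball 0 (\<rho> n) \<subseteq> V n" "0 \<in> ball 0 (\<rho> n)" using rV \<rho>(1) by auto
    have "(q n has_field_derivative deriv (q n) 0) (at (of_real (\<rho> n) * 0))"
      using holomorphic_derivI[OF holomorphic_on_subset[OF qhol 0(1)] open_ball 0(2)] by simp
    moreover have "((\<lambda>z. of_real (\<rho> n) * z) has_field_derivative of_real (\<rho> n)) (at 0)"
      by (auto intro!: derivative_eq_intros)
    ultimately have "(P n has_field_derivative deriv (q n) 0 * of_real (\<rho> n)) (at 0)"
      unfolding P_def[abs_def] using DERIV_chain2 by blast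
    then show ?thesis using \<rho>(1)[of n] by (simp add: DERIV_imp_deriv norm_mult)
  qed
  have "m \<le> norm (deriv p 0)"
  proof (rule LIMSEQ_le)
    show "(\<lambda>n. \<rho> (k n) * m) \<longlonglongrightarrow> m" using tendsto_mult_right[OF \<rho>k, of m] by simp
    show "(\<lambda>n. norm (deriv (P (k n)) 0)) \<longlonglongrightarrow> norm (deriv p 0)"
      using uniform_limit_deriv[of "ball 0 1" 0 "P \<circ> k" p] lim Phol by (intro tendsto_norm) (simp add: o_def)
    show "\<exists>N. \<forall>n\<ge>N. \<rho> (k n) * m \<le> norm (deriv (P (k n)) 0)"
      using m(2) \<rho>(1) by (auto simp: dP intro!: mult_left_mono less_imp_le)
  qed
  then have dp: "deriv p 0 \<noteq> 0" using m(1) by auto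
  have nonconst: "\<not> p constant_on ball 0 1"
  proof
    assume "p constant_on ball 0 1"
    then obtain c where c: "\<And>z. z \<in> ball 0 1 \<Longrightarrow> p z = c" by (auto simp: constant_on_def)
    have "(p has_field_derivative 0) (at 0)"
      using has_field_derivative_transform_within_open[of "\<lambda>_. c" 0 0 "ball 0 1" p] c by auto
    then show False using dp DERIV_imp_deriv by blast
  qed
  have pD: "p z \<in> D" if z: "norm z < 1" for z
  proof (rule ccontr)
    assume "p z \<notin> D"
    have "p z - p z \<noteq> 0"
    proof (rule Hurwitz_no_zeros[of "ball 0 1" "\<lambda>n x. P (k n) x - p z" "\<lambda>x. p x - p z"])
      show "\<not> (\<lambda>x. p x - p z) constant_on ball 0 1"
        using nonconst unfolding constant_on_def by (metis diff_add_cancel)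
      show "uniform_limit K (\<lambda>n x. P (k n) x - p z) (\<lambda>x. p x - p z) sequentially"
        if "compact K" "K \<subseteq> ball 0 1" for K
        using lim[OF that] by (intro uniform_limit_intros) (simp add: o_def)
      show "P (k n) x - p z \<noteq> 0" if "x \<in> ball 0 1" for n x
        using PD[of x "k n"] that \<open>p z \<notin> D\<close> by auto
    qed (use z Phol p in \<open>auto intro!: holomorphic_intros\<close>)
    then show False by simp
  qed
  have "ball_sections (ball 0 1) p D"
    unfolding ball_sections_def
  proof (intro conjI allI impI)
    show "p holomorphic_on ball 0 1" by (rule p)
    show "p ` ball 0 1 \<subseteq> D" using pD by auto
    fix c r z assume *: "ball c r \<subseteq> D \<and> z \<in> ball 0 1 \<and> p z \<in> ball c r"
    then have z: "norm z < 1" by simp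
    have cz: "(\<lambda>n. P (k n) z) \<longlonglongrightarrow> p z" using ptw[of "\<lambda>_. z" z] z by simp
    obtain N where N: "\<And>n. n \<ge> N \<Longrightarrow> P (k n) z \<in> ball c r"
      using topological_tendstoD[OF cz open_ball, of c r] * unfolding eventually_sequentially by blast
    have "\<exists>g. g holomorphic_on ball c r \<and> g ` ball c r \<subseteq> V (k (n + N)) \<and>
        (\<forall>w\<in>ball c r. q (k (n + N)) (g w) = w) \<and> g (P (k (n + N)) z) = of_real (\<rho> (k (n + N))) * z" for n
      using ball_sectionsD[OF sec, of c r "of_real (\<rho> (k (n + N))) * z" "k (n + N)"] N[of "n + N"] * inV[OF z]
      unfolding P_def by (metis le_add2)
    then obtain G where G: "\<And>n. G n holomorphic_on ball c r" "\<And>n. G n ` ball c r \<subseteq> V (k (n + N))"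
        "\<And>n w. w \<in> ball c r \<Longrightarrow> q (k (n + N)) (G n w) = w"
        "\<And>n. G n (P (k (n + N)) z) = of_real (\<rho> (k (n + N))) * z"
      by metis
    have G1: "norm (G n w) < 1" if "w \<in> ball c r" for n w
    proof -
      have "G n w \<in> ball 0 1" using G(2)[of n] V[of "k (n + N)"] that by blast
      then show ?thesis by simp
    qed
    have bd: "\<exists>B. \<forall>h\<in>range G. \<forall>w\<in>K. norm (h w) \<le> B" if "compact K" "K \<subseteq> ball c r" for K
      using G1 that(2) by (intro exI[of _ 1]) (auto intro!: less_imp_le simp: subset_iff)
    have hol: "h holomorphic_on ball c r" if "h \<in> range G" for h using that G(1) by auto
    obtain g j where g: "g holomorphic_on ball c r" and j: "strict_mono (j :: nat \<Rightarrow> nat)"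
      and limG: "\<And>K. \<lbrakk>compact K; K \<subseteq> ball c r\<rbrakk> \<Longrightarrow> uniform_limit K (G \<circ> j) g sequentially"
      by (rule Montel[OF open_ball hol bd order_refl]) (assumption | rule that)+
    have gc: "continuous_on (ball c r) g" using g by (rule holomorphic_on_imp_continuous_on)
    have ptwG: "(\<lambda>n. G (j n) (x n)) \<longlonglongrightarrow> g y" if "x \<longlonglongrightarrow> y" "y \<in> ball c r" for x y
      using uniform_limit_along[OF open_ball that(2) gc limG that(1)] by (simp add: o_def)
    have jN: "filterlim (\<lambda>n. j n + N) sequentially sequentially"
      using filterlim_subseq[OF j] by (rule filterlim_at_top_mono) simp
    define l where "l n = k (j n + N)" for n
    have \<rho>l: "(\<lambda>n. \<rho> (l n)) \<longlonglongrightarrow> 1" unfolding l_def by (rule filterlim_compose[OF \<rho>k jN])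
    have gz: "g (p z) = z"
    proof (rule LIMSEQ_unique)
      show "(\<lambda>n. G (j n) (P (l n) z)) \<longlonglongrightarrow> g (p z)"
        using * by (intro ptwG filterlim_compose[OF cz jN, folded l_def]) auto
      have "(\<lambda>n. of_real (\<rho> (l n)) * z) \<longlonglongrightarrow> of_real 1 * z"
        by (intro tendsto_intros \<rho>l)
      then show "(\<lambda>n. G (j n) (P (l n) z)) \<longlonglongrightarrow> z" by (simp add: G(4) l_def)
    qed
    have gle: "norm (g w) \<le> 1" if "w \<in> ball c r" for w
      using ptwG[of "\<lambda>_. w" w] that G1
      by (intro LIMSEQ_le_const2[of "\<lambda>n. norm (G (j n) w)" "norm (g w)"] tendsto_norm)
         (auto intro!: less_imp_le)
    have glt: "norm (g w) < 1" if w: "w \<in> ball c r" for w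
    proof (rule ccontr)
      assume "\<not> norm (g w) < 1"
      then have "norm (g w) = 1" using gle[OF w] by simp
      then have "g constant_on ball c r"
        using maximum_modulus_principle[OF g open_ball connected_ball open_ball order_refl w] gle by simp
      then have "g w = g (p z)" using w * unfolding constant_on_def by metis
      then show False using gz z \<open>norm (g w) = 1\<close> by simp
    qed
    have pg: "p (g w) = w" if w: "w \<in> ball c r" for w
    proof (rule LIMSEQ_unique)
      define x where "x n = G (j n) w / of_real (\<rho> (l n))" for n
      have "x \<longlonglongrightarrow> g w / of_real 1"
        unfolding x_def by (intro tendsto_intros ptwG \<rho>l w) auto
      then have xl: "x \<longlonglongrightarrow> g w" by simp
      have ulim: "uniform_limit K ((P \<circ> k) \<circ> (\<lambda>n. j n + N)) p sequentially" if "compact K" "K \<subseteq> ball 0 1" for K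
        unfolding o_def by (rule filterlim_compose[OF lim[OF that, unfolded o_def] jN])
      show "(\<lambda>n. P (l n) (x n)) \<longlonglongrightarrow> p (g w)"
        using uniform_limit_along[OF open_ball _ pc ulim xl] glt[OF w] by (simp add: o_def l_def)
      have "P (l n) (x n) = w" for n
        using G(3)[OF w, of "j n"] \<rho>(1)[of "l n"] by (simp add: P_def x_def l_def)
      then show "(\<lambda>n. P (l n) (x n)) \<longlonglongrightarrow> w" by simp
    qed
    show "\<exists>g. g holomorphic_on ball c r \<and> g ` ball c r \<subseteq> ball 0 1 \<and> (\<forall>w\<in>ball c r. p (g w) = w) \<and> g (p z) = z"
      using g glt pg gz by (intro exI[of _ g]) auto
  qed
  then show ?thesis using that p0 by blast
qed

text \<open>Minimise \<open>|q'(0)|\<close> over the pairs of an open subset \<open>V\<close> of the disc containing \<open>0\<close> and a map \<open>q\<close> on it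
with sections over \<open>D\<close> and a prescribed value at \<open>0\<close>.
The infimum \<open>m\<close> is positive by Cauchy's estimate. A point missing from \<open>V\<close> at distance less than \<open>\<rho>\<close>
from \<open>0\<close> allows a square root step that shrinks the derivative by a factor at most \<open>\<kappa> < 1\<close>, so it cannot
occur once \<open>|q'(0)| < m / \<kappa>\<close>. Hence near-minimal pairs contain arbitrarily large discs.\<close>
theorem universal_covering_exists:
  assumes D: "open D" "connected D" and ab: "a \<noteq> b" "a \<notin> D" "b \<notin> D"
    and V0: "ball_sections V0 q0 D" "open V0" "V0 \<subseteq> ball 0 1" "0 \<in> V0"
  shows "\<exists>p. holomorphic_universal_covering p D"
proof -
  define w0 where "w0 = q0 0"
  define adm where "adm V q \<longleftrightarrow> ball_sections V q D \<and> open V \<and> V \<subseteq> ball 0 1 \<and> 0 \<in> V \<and> q 0 = w0" for V q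
  define A where "A = {norm (deriv q 0) | V q. adm V q}"
  have "adm V0 q0" using V0 by (simp add: adm_def w0_def)
  then have A0: "A \<noteq> {}" by (auto simp: A_def)
  have "w0 \<in> D" using V0 by (auto simp: ball_sections_def w0_def)
  then obtain r where r: "r > 0" "ball w0 r \<subseteq> D" using D(1) openE by blast
  have low: "r / 2 \<le> norm (deriv q 0)" if "adm V q" for V q
    using ball_sections_deriv_bound[of V q D 0 r] that r by (auto simp: adm_def)
  define m where "m = Inf A"
  have bdd: "bdd_below A" using low by (intro bdd_belowI[of _ "r/2"]) (auto simp: A_def)
  have "r / 2 \<le> m" unfolding m_def using low by (intro cInf_greatest[OF A0]) (auto simp: A_def)
  then have m: "m > 0" using r by simp
  have m_le: "m \<le> norm (deriv q 0)" if "adm V q" for V q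
    unfolding m_def using bdd that by (intro cInf_lower) (auto simp: A_def)
  have large: "\<exists>V q. adm V q \<and> ball 0 \<rho> \<subseteq> V" if \<rho>: "0 < \<rho>" "\<rho> < 1" for \<rho> :: real
  proof -
    define \<kappa> where "\<kappa> = 1 - (1 - sqrt \<rho>)\<^sup>2 / 2"
    have sq: "0 < sqrt \<rho>" "sqrt \<rho> < 1" using \<rho> by auto
    have "(1 - sqrt \<rho>)\<^sup>2 > 0" "(1 - sqrt \<rho>)\<^sup>2 \<le> 1"
      using sq by (auto simp: power_le_one)
    then have \<kappa>: "0 < \<kappa>" "\<kappa> < 1" by (auto simp: \<kappa>_def)
    have "m < m / \<kappa>" using m \<kappa> by (simp add: field_simps)
    then obtain x where "x \<in> A" "x < m / \<kappa>"
      using cInf_lessD[OF A0, of "m / \<kappa>"] by (auto simp: m_def)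
    then obtain V q where Vq: "adm V q" "norm (deriv q 0) < m / \<kappa>"
      by (auto simp: A_def)
    have "ball 0 \<rho> \<subseteq> V"
    proof (rule ccontr)
      assume "\<not> ball 0 \<rho> \<subseteq> V"
      then obtain x where "x \<in> ball 0 \<rho>" and xV: "x \<notin> V" by blast
      then have x: "norm x < \<rho>" "x \<notin> V" by auto
      then have "x \<in> ball 0 1" using \<rho> by simp
      then obtain V' q' where "adm V' q'"
        and e: "norm (deriv q' 0) = norm (deriv q 0) * (2 * sqrt (norm x) / (1 + norm x))"
        using Koebe_square_root_step[of V q D x thesis] Vq(1) x(2) unfolding adm_def by metis
      define t where "t = sqrt (norm x)"
      have t: "0 \<le> t" "t \<le> sqrt \<rho>" "norm x = t\<^sup>2" using x by (auto simp: t_def)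
      have t1: "t\<^sup>2 \<le> 1" using order_trans[OF t(2) less_imp_le[OF sq(2)]] t(1) by (intro power_le_one)
      \<comment> \<open>the contraction factor falls short of \<open>1\<close> by a square\<close>
      have "2 * t / (1 + t\<^sup>2) = 1 - (1 - t)\<^sup>2 / (1 + t\<^sup>2)"
        by (simp add: field_simps power2_eq_square add_pos_nonneg add_nonneg_eq_0_iff) 
      also have "(1 - t)\<^sup>2 / (1 + t\<^sup>2) \<ge> (1 - sqrt \<rho>)\<^sup>2 / 2"
        using t t1 sq by (intro frac_le power_mono) (auto simp: add_pos_nonneg)
      then have "1 - (1 - t)\<^sup>2 / (1 + t\<^sup>2) \<le> \<kappa>" by (simp add: \<kappa>_def)
      finally have "norm (deriv q' 0) \<le> norm (deriv q 0) * \<kappa>"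
        unfolding e t(3)[symmetric] t_def[symmetric] using t(3) by (intro mult_left_mono) auto
      also have "\<dots> < m" using Vq(2) \<kappa> by (simp add: field_simps)
      finally show False using m_le[OF \<open>adm V' q'\<close>] by simp
    qed
    then show ?thesis using Vq by blast
  qed
  \<comment> \<open>any sequence in the open unit interval with limit \<open>1\<close>\<close>
  define \<rho> where "\<rho> n = 1 - inverse (real (n + 2))" for n
  have \<rho>: "0 < \<rho> n" "\<rho> n < 1" for n by (simp_all add: \<rho>_def field_simps)
  have "\<rho> \<longlonglongrightarrow> 1 - 0"
    unfolding \<rho>_def[abs_def] using LIMSEQ_ignore_initial_segment[OF LIMSEQ_inverse_real_of_nat, of 1]
    by (intro tendsto_diff tendsto_const) (simp add: add.commute)
  then have lim: "\<rho> \<longlonglongrightarrow> 1" by simp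
  obtain V q where Vq: "\<And>n. adm (V n) (q n)" "\<And>n. ball 0 (\<rho> n) \<subseteq> V n"
    using large[OF \<rho>] by metis
  obtain p where "ball_sections (ball 0 1) p D" "p 0 = w0"
  proof (rule ball_sections_limit[of V q D \<rho> w0 m a b])
    show "m \<le> norm (deriv (q n) 0)" for n using m_le[OF Vq(1)] .
  qed (use Vq \<rho> lim m ab in \<open>auto simp: adm_def\<close>)
  then show ?thesis
    unfolding holomorphic_universal_covering_def
    using covering_space_if_ball_sections[of "ball 0 1" p D] D by (auto simp: ball_sections_def)
qed

section \<open>A branched covering by the disc from holomorphic dynamics\<close>

text \<open>A Blaschke product of degree two with an attracting fixed point at \<open>0\<close> of multiplier \<open>1/2\<close>. The multiplier
is chosen because the critical values of the linearising coordinate then form the progression \<open>-(2^k)\<close>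
after normalisation.\<close>
definition blaschke :: "complex \<Rightarrow> complex" where
  "blaschke z = z * (2 * z + 1) / (2 + z)"

text \<open>The equation \<open>blaschke z = y\<close> is quadratic in \<open>z\<close> with discriminant \<open>y\<^sup>2 + 14 * y + 1\<close>; this is its only
zero in the disc.\<close>
definition blaschke_crit_value :: complex where "blaschke_crit_value = of_real (4 * sqrt 3 - 7)"

lemma norm_blaschke_factors:
  "(norm (2 * z + 1))\<^sup>2 = 4 * (norm z)\<^sup>2 + 4 * Re z + 1" "(norm (2 + z))\<^sup>2 = 4 + 4 * Re z + (norm z)\<^sup>2"
  unfolding cmod_power2 by (simp_all add: power2_eq_square algebra_simps)

lemma two_plus_nonzero:
  assumes "norm (z :: complex) < 1"
  shows "2 + z \<noteq> 0"
  using norm_diff_ineq[of 2 z] assms by auto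

text \<open>The modulus of the Blaschke factor \<open>(2 * z + 1) / (2 + z)\<close> on a circle about \<open>0\<close> is largest on the positive
axis.\<close>
lemma blaschke_norm_le:
  assumes "norm z < 1"
  shows "norm (blaschke z) \<le> norm z * ((2 * norm z + 1) / (2 + norm z))"
proof -
  define r where "r = norm z"
  have r: "0 \<le> r" "r < 1" "Re z \<le> r" using assms complex_Re_le_cmod[of z] by (auto simp: r_def)
  note ne = two_plus_nonzero[OF assms]
  have "(2 * r + 1)\<^sup>2 * (norm (2 + z))\<^sup>2 - (2 + r)\<^sup>2 * (norm (2 * z + 1))\<^sup>2 = 12 * (1 - r\<^sup>2) * (r - Re z)"
    unfolding norm_blaschke_factors r_def[symmetric] by (simp add: power2_eq_square algebra_simps)
  also have "\<dots> \<ge> 0" using r by (intro mult_nonneg_nonneg) (auto simp: power_le_one)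
  finally have "((2 + r) * norm (2 * z + 1))\<^sup>2 \<le> ((2 * r + 1) * norm (2 + z))\<^sup>2"
    by (simp add: power_mult_distrib)
  then have "(2 + r) * norm (2 * z + 1) \<le> (2 * r + 1) * norm (2 + z)"
    by (rule power2_le_imp_le) (use r in auto)
  then have "norm (2 * z + 1) / norm (2 + z) \<le> (2 * r + 1) / (2 + r)"
    using r ne by (simp add: divide_simps mult_ac)
  then have "norm z * (norm (2 * z + 1) / norm (2 + z)) \<le> norm z * ((2 * r + 1) / (2 + r))"
    by (intro mult_left_mono) auto
  then show ?thesis by (simp add: blaschke_def norm_mult norm_divide r_def)
qed

lemma blaschke_ratio_mono:
  assumes "0 \<le> s" "s \<le> (r::real)"
  shows "(2 * s + 1) / (2 + s) \<le> (2 * r + 1) / (2 + r)"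
  using assms by (simp add: divide_simps) (simp add: algebra_simps)

lemma blaschke_ratio_less_1: "0 \<le> (r::real) \<Longrightarrow> r < 1 \<Longrightarrow> (2 * r + 1) / (2 + r) < 1"
  by (simp add: divide_simps)

lemma blaschke_norm_le_self: "norm z < 1 \<Longrightarrow> norm (blaschke z) \<le> norm z"
  using blaschke_norm_le[of z] blaschke_ratio_less_1[of "norm z"] mult_left_le[of "(2 * norm z + 1) / (2 + norm z)" "norm z"]
  by auto

lemma blaschke_norm_less_1: "norm z < 1 \<Longrightarrow> norm (blaschke z) < 1"
  using blaschke_norm_le_self[of z] by auto

lemma blaschke_pre_disc:
  fixes z :: complex
  assumes e: "z * (2 * z + 1) = y * (2 + z)" and y: "norm y < 1"
  shows "norm z < 1"
proof (rule ccontr)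
  assume "\<not> norm z < 1"
  then have z: "norm z \<ge> 1" by simp
  have "(norm (2 + z))\<^sup>2 \<le> (norm (2 * z + 1))\<^sup>2"
    using one_le_power[OF z, of 2] by (simp add: norm_blaschke_factors)
  then have le: "norm (2 + z) \<le> norm (2 * z + 1)" by (rule power2_le_imp_le) auto
  have "norm (2 + z) \<le> norm z * norm (2 * z + 1)"
    using le z mult_mono[of 1 "norm z" "norm (2 + z)" "norm (2 * z + 1)"] by simp
  also have "\<dots> = norm y * norm (2 + z)" using e by (metis norm_mult)
  finally have "norm (2 + z) = 0"
    using mult_strict_right_mono[OF y, of "norm (2 + z)"] by (cases "norm (2 + z) = 0") auto
  then have "z = -2" by (simp add: add_eq_0_iff)
  then show False using e by simp
qed

lemma blaschke_holomorphic: "blaschke holomorphic_on ball 0 1"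
  unfolding blaschke_def[abs_def] using two_plus_nonzero by (intro holomorphic_intros) auto

lemma blaschke_0 [simp]: "blaschke 0 = 0" by (simp add: blaschke_def)

lemma blaschke_iter_disc: "norm z < 1 \<Longrightarrow> norm ((blaschke ^^ n) z) \<le> norm z"
  by (induction n) (auto intro: order_trans[OF blaschke_norm_le_self])

lemma blaschke_iter_0 [simp]: "(blaschke ^^ n) 0 = 0" by (induction n) auto

lemma blaschke_iter_holomorphic: "(blaschke ^^ n) holomorphic_on ball 0 1"
proof (induction n)
  case 0 then show ?case by (simp add: id_def)
next
  case (Suc n)
  have "(blaschke ^^ n) ` ball 0 1 \<subseteq> ball 0 1" using blaschke_iter_disc by (force intro: le_less_trans)
  then show ?case using holomorphic_on_compose_gen[OF Suc blaschke_holomorphic] by (simp add: o_def)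
qed

lemma blaschke_iter_le_geometric:
  assumes z: "norm z \<le> r" and r: "r < 1"
  shows "norm ((blaschke ^^ n) z) \<le> ((2 * r + 1) / (2 + r)) ^ n"
proof (induction n)
  case 0 then show ?case using z r by simp
next
  case (Suc n)
  define \<rho> where "\<rho> = (2 * r + 1) / (2 + r)"
  have r0: "0 \<le> r" using z norm_ge_zero order_trans by blast
  then have \<rho>: "0 \<le> \<rho>" by (simp add: \<rho>_def)
  define u where "u = (blaschke ^^ n) z"
  have u: "norm u \<le> r" using blaschke_iter_disc[of z n] z r by (simp add: u_def)
  have "norm (blaschke u) \<le> norm u * ((2 * norm u + 1) / (2 + norm u))" using u r by (intro blaschke_norm_le) auto
  also have "\<dots> \<le> norm u * \<rho>" unfolding \<rho>_def using blaschke_ratio_mono[of "norm u" r] u by (intro mult_left_mono) auto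
  also have "\<dots> \<le> \<rho> ^ n * \<rho>" using Suc \<rho> by (intro mult_right_mono) (auto simp: u_def \<rho>_def)
  finally show ?case unfolding \<rho>_def by (simp add: u_def mult.commute)
qed

text \<open>One step of the iteration multiplies \<open>2 ^ n * |z\<^sub>n|\<close> by at most \<open>1 + 3 * s / (2 + s) \<le> exp (3/2 * s)\<close>, where
\<open>s = |z\<^sub>n|\<close>, and the numbers \<open>|z\<^sub>n|\<close> are dominated by a convergent geometric series.\<close>
lemma blaschke_iter_decay:
  assumes z: "norm z \<le> r" and r: "r < 1"
  shows "2 ^ n * norm ((blaschke ^^ n) z) \<le> exp (3 / 2 * (1 / (1 - (2 * r + 1) / (2 + r))))"
proof -
  define \<rho> where "\<rho> = (2 * r + 1) / (2 + r)"
  have r0: "0 \<le> r" using z norm_ge_zero order_trans by blast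
  have \<rho>: "0 \<le> \<rho>" "\<rho> < 1" using r0 blaschke_ratio_less_1[OF r0 r] by (auto simp: \<rho>_def)
  have "2 ^ n * norm ((blaschke ^^ n) z) \<le> exp (3 / 2 * (\<Sum>k<n. \<rho> ^ k))"
  proof (induction n)
    case 0 then show ?case using z r by simp
  next
    case (Suc n)
    define u where "u = (blaschke ^^ n) z"
    define s where "s = norm u"
    have s: "0 \<le> s" "s < 1" "s \<le> \<rho> ^ n" using blaschke_iter_disc[of z n] z r blaschke_iter_le_geometric[OF z r, of n]
      by (auto simp: u_def s_def \<rho>_def)
    have "2 * norm (blaschke u) \<le> 2 * (s * ((2 * s + 1) / (2 + s)))" using s blaschke_norm_le[of u] by (auto simp: s_def)
    also have "\<dots> = s * (1 + 3 * s / (2 + s))" using s by (simp add: field_simps)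
    also have "\<dots> \<le> s * exp (3 / 2 * \<rho> ^ n)"
    proof (intro mult_left_mono s)
      have "3 * s / (2 + s) \<le> 3 * s / 2" using s by (intro divide_left_mono) auto
      also have "\<dots> \<le> 3 / 2 * \<rho> ^ n" using s by simp
      finally show "1 + 3 * s / (2 + s) \<le> exp (3 / 2 * \<rho> ^ n)"
        using exp_ge_add_one_self[of "3 / 2 * \<rho> ^ n"] by linarith
    qed
    finally have "2 ^ Suc n * norm (blaschke u) \<le> 2 ^ n * s * exp (3 / 2 * \<rho> ^ n)" by simp
    also have "\<dots> \<le> exp (3 / 2 * (\<Sum>k<n. \<rho> ^ k)) * exp (3 / 2 * \<rho> ^ n)"
      using Suc by (intro mult_right_mono) (auto simp: s_def u_def)
    also have "\<dots> = exp (3 / 2 * (\<Sum>k<Suc n. \<rho> ^ k))" by (simp add: exp_add[symmetric] algebra_simps)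
    finally show ?case by (simp add: u_def)
  qed
  also have "(\<Sum>k<n. \<rho> ^ k) \<le> 1 / (1 - \<rho>)"
    using \<rho> sum_gp_strict[of \<rho> n] by (simp add: divide_right_mono)
  then have "exp (3 / 2 * (\<Sum>k<n. \<rho> ^ k)) \<le> exp (3 / 2 * (1 / (1 - \<rho>)))"
    unfolding exp_le_cancel_iff by (rule mult_left_mono) auto
  finally show ?thesis by (simp add: \<rho>_def)
qed

text \<open>The linearising (Koenigs) coordinate of the fixed point \<open>0\<close>. The increments of \<open>2 ^ n * (blaschke ^^ n) z\<close>
are \<open>3 * 2 ^ n * u\<^sup>2 / (2 + u)\<close> with \<open>u = (blaschke ^^ n) z\<close>, which by the decay of \<open>u\<close> is at most a
constant times \<open>2 ^ (-n)\<close>, uniformly on smaller discs.\<close>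
lemma Koenigs_exists:
  obtains \<phi> where "\<phi> holomorphic_on ball 0 1"
    "\<And>z. norm z < 1 \<Longrightarrow> (\<lambda>n. 2 ^ n * (blaschke ^^ n) z) \<longlonglongrightarrow> \<phi> z"
    "\<And>z. norm z < 1 \<Longrightarrow> \<phi> (blaschke z) = \<phi> z / 2" "\<phi> 0 = 0" "deriv \<phi> 0 = 1"
proof -
  define F where "F n z = 2 ^ n * (blaschke ^^ n) z" for n z
  define d where "d n z = F (Suc n) z - F n z" for n z
  define \<phi> where "\<phi> z = z + suminf (\<lambda>n. d n z)" for z
  have sumd: "z + (\<Sum>i<n. d i z) = F n z" for n z
    unfolding d_def by (subst sum_lessThan_telescope) (simp add: F_def)
  have ul: "uniform_limit (cball 0 r) F \<phi> sequentially" if r: "r < 1" for r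
  proof -
    define C where "C = exp (3 / 2 * (1 / (1 - (2 * r + 1) / (2 + r))))"
    have "uniform_limit (cball 0 r) (\<lambda>n z. \<Sum>i<n. d i z) (\<lambda>z. suminf (\<lambda>i. d i z)) sequentially"
    proof (rule Weierstrass_m_test)
      fix n z assume "z \<in> cball (0::complex) r"
      then have z: "norm z \<le> r" by simp
      define u where "u = (blaschke ^^ n) z"
      have C: "2 ^ n * norm u \<le> C" using blaschke_iter_decay[OF z r] by (simp add: u_def C_def)
      have u: "norm u < 1" using blaschke_iter_disc[of z n] z r by (simp add: u_def)
      have n2: "norm (2 + u) \<ge> 1" using norm_diff_ineq[of 2 u] u by simp
      have ne: "2 + u \<noteq> 0" using n2 by auto
      have "d n z = 2 ^ n * (u * (3 * u / (2 + u)))"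
        using ne by (simp add: d_def F_def u_def[symmetric] blaschke_def field_simps)
      then have "norm (d n z) = 2 ^ n * (norm u * (3 * norm u / norm (2 + u)))"
        by (simp add: norm_mult norm_divide norm_power)
      also have "\<dots> \<le> 2 ^ n * (norm u * (3 * norm u / 1))"
        using n2 by (intro mult_left_mono divide_left_mono) auto
      also have "\<dots> = 3 * (2 ^ n * norm u)\<^sup>2 * (1 / 2) ^ n"
        by (simp add: power2_eq_square power_divide)
      also have "\<dots> \<le> 3 * C\<^sup>2 * (1 / 2) ^ n"
        using C by (intro mult_right_mono mult_left_mono power_mono) auto
      finally show "norm (d n z) \<le> 3 * C\<^sup>2 * (1 / 2) ^ n" .
    qed (intro summable_mult summable_geometric, simp)
    then have "uniform_limit (cball 0 r) (\<lambda>n z. z + (\<Sum>i<n. d i z)) (\<lambda>z. z + suminf (\<lambda>i. d i z)) sequentially"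
      by (intro uniform_limit_intros)
    then show ?thesis by (simp add: sumd \<phi>_def[abs_def])
  qed
  have Fhol: "F n holomorphic_on ball 0 1" for n
    unfolding F_def[abs_def] by (intro holomorphic_intros blaschke_iter_holomorphic)
  have hol: "\<phi> holomorphic_on ball 0 1"
  proof (rule holomorphic_uniform_sequence[of _ F])
    fix x :: complex assume "x \<in> ball 0 1"
    then obtain e where e: "e > 0" "cball x e \<subseteq> ball 0 1" using open_contains_cball open_ball by blast
    \<comment> \<open>the ball of radius \<open>e\<close> about \<open>x\<close> reaches the modulus \<open>|x| + e\<close> in the direction of \<open>x\<close>\<close>
    have "norm x + e < 1"
    proof (cases "x = 0")
      case True
      then have "of_real e \<in> cball x e" using e(1) by simp
      then have "norm (of_real e :: complex) < 1" using e(2) by (metis mem_ball_0 subsetD)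
      then show ?thesis using e True by simp
    next
      case False
      define y where "y = x + of_real e * (x / of_real (norm x))"
      have "y \<in> cball x e" using e False by (simp add: y_def dist_norm norm_mult norm_divide)
      then have "norm y < 1" using e(2) by auto
      moreover have "y = of_real ((norm x + e) / norm x) * x" using False by (simp add: y_def field_simps)
      then have "norm y = (norm x + e) / norm x * norm x" using e(1) by (simp only: norm_mult norm_of_real) (simp add: abs_of_nonneg)
      ultimately show ?thesis using False by simp
    qed
    moreover have "cball x e \<subseteq> cball 0 (norm x + e)" by (simp add: cball_subset_cball_iff)
    ultimately have "uniform_limit (cball x e) F \<phi> sequentially"
      using uniform_limit_on_subset[OF ul] by blast
    then show "\<exists>d>0. cball x d \<subseteq> ball 0 1 \<and> uniform_limit (cball x d) F \<phi> sequentially"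
      using e by blast
  qed (use Fhol in auto)
  have lim: "(\<lambda>n. F n z) \<longlonglongrightarrow> \<phi> z" if "norm z < 1" for z
    using tendsto_uniform_limitI[OF ul[OF that], of z] by simp
  have fe: "\<phi> (blaschke z) = \<phi> z / 2" if z: "norm z < 1" for z
  proof (rule LIMSEQ_unique[OF lim[OF blaschke_norm_less_1[OF z]]])
    have "(\<lambda>n. F (Suc n) z) \<longlonglongrightarrow> \<phi> z" using lim[OF z] by (rule LIMSEQ_Suc)
    then have "(\<lambda>n. F (Suc n) z / 2) \<longlonglongrightarrow> \<phi> z / 2" by (intro tendsto_intros) auto
    moreover have "F (Suc n) z / 2 = F n (blaschke z)" for n
      by (simp add: F_def funpow_swap1)
    ultimately show "(\<lambda>n. F n (blaschke z)) \<longlonglongrightarrow> \<phi> z / 2" by simp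
  qed
  have d0: "((blaschke ^^ n) has_field_derivative (1/2) ^ n) (at 0)" for n
  proof (induction n)
    case 0 then show ?case by (simp add: id_def)
  next
    case (Suc n)
    have "(blaschke has_field_derivative 1/2) (at 0)"
      unfolding blaschke_def[abs_def] by (auto intro!: derivative_eq_intros)
    then have "(blaschke has_field_derivative 1/2) (at ((blaschke ^^ n) 0))" by simp
    from DERIV_chain[OF this Suc] show ?case by (simp add: o_def)
  qed
  have "deriv (F n) 0 = 1" for n
  proof -
    have "(F n has_field_derivative 2 ^ n * (1/2) ^ n) (at 0)"
      unfolding F_def[abs_def] by (intro DERIV_cmult d0)
    then show ?thesis by (simp add: DERIV_imp_deriv power_divide)
  qed
  moreover have "(\<lambda>n. (deriv ^^ 1) (F n) 0) \<longlonglongrightarrow> (deriv ^^ 1) \<phi> 0"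
  proof (rule higher_deriv_complex_uniform_limit[where A = "ball 0 (1/2)"])
    show "uniform_limit (ball 0 (1/2)) F \<phi> sequentially"
      using uniform_limit_on_subset[OF ul[of "1/2"] ball_subset_cball] by simp
    show "\<forall>\<^sub>F n in sequentially. F n holomorphic_on ball 0 (1/2)"
      by (intro always_eventually allI holomorphic_on_subset[OF Fhol]) auto
  qed auto
  ultimately have "deriv \<phi> 0 = 1" by (simp add: LIMSEQ_const_iff)
  moreover have "\<phi> 0 = 0" using lim[of 0] by (simp add: F_def LIMSEQ_const_iff)
  ultimately show ?thesis using that hol lim fe unfolding F_def by blast
qed

text \<open>A map on a ball that avoids the critical value lifts through the Blaschke product: the discriminant of the
quadratic equation has a holomorphic square root on the ball, and its sign is chosen to hit \<open>z\<close>.\<close>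
lemma blaschke_lift_step:
  assumes h: "h holomorphic_on ball c r" "h ` ball c r \<subseteq> ball 0 1" "\<And>w. w \<in> ball c r \<Longrightarrow> h w \<noteq> blaschke_crit_value"
    and b: "b \<in> ball c r" and z: "norm z < 1" "blaschke z = h b"
  obtains h' where "h' holomorphic_on ball c r" "h' ` ball c r \<subseteq> ball 0 1" "h' b = z"
     "\<And>w. w \<in> ball c r \<Longrightarrow> blaschke (h' w) = h w"
proof -
  define \<Delta> where "\<Delta> y = y\<^sup>2 + 14 * y + 1" for y :: complex
  have hD: "norm (h w) < 1" if "w \<in> ball c r" for w using subsetD[OF h(2) imageI[OF that]] by simp
  have s3: "(complex_of_real (sqrt 3))\<^sup>2 = 3" by (simp flip: of_real_power)
  have \<Delta>: "\<Delta> y = (y - blaschke_crit_value) * (y + of_real (4 * sqrt 3 + 7))" for y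
    using s3 by (simp add: \<Delta>_def blaschke_crit_value_def power2_eq_square algebra_simps)
  have \<Delta>0: "\<Delta> (h w) \<noteq> 0" if w: "w \<in> ball c r" for w
  proof
    assume "\<Delta> (h w) = 0"
    then have "h w = - of_real (4 * sqrt 3 + 7)" using \<Delta> h(3)[OF w] by (simp add: add_eq_0_iff2)
    then have "norm (h w) = \<bar>4 * sqrt 3 + 7\<bar>" by (simp only: norm_minus_cancel norm_of_real)
    then show False using hD[OF w] real_sqrt_ge_zero[of 3] by linarith
  qed
  have "(\<lambda>w. \<Delta> (h w)) holomorphic_on ball c r" unfolding \<Delta>_def by (intro holomorphic_intros h)
  then obtain s0 where s0: "s0 holomorphic_on ball c r" "\<And>w. w \<in> ball c r \<Longrightarrow> \<Delta> (h w) = (s0 w)\<^sup>2"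
    using contractible_imp_holomorphic_sqrt[of "\<lambda>w. \<Delta> (h w)" "ball c r" thesis] \<Delta>0 convex_imp_contractible[OF convex_ball]
    by metis
  note ne2 = two_plus_nonzero
  have "z * (2 * z + 1) = h b * (2 + z)" using z ne2[OF z(1)] by (simp add: blaschke_def field_simps)
  then have "\<Delta> (h b) = (4 * z + 1 - h b)\<^sup>2" unfolding \<Delta>_def by algebra
  then have sg: "s0 b = 4 * z + 1 - h b \<or> s0 b = - (4 * z + 1 - h b)" using s0(2)[OF b] by (simp add: power2_eq_iff)
  obtain s where s: "s holomorphic_on ball c r" "\<And>w. w \<in> ball c r \<Longrightarrow> \<Delta> (h w) = (s w)\<^sup>2"
     "s b = 4 * z + 1 - h b"
  proof (cases "s0 b = 4 * z + 1 - h b")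
    case True then show ?thesis using that[of s0] s0 by blast
  next
    case False
    then show ?thesis using that[of "\<lambda>w. - s0 w"] s0 sg by (auto intro!: holomorphic_intros)
  qed
  define h' where "h' w = (h w - 1 + s w) / 4" for w
  have eq: "h' w * (2 * h' w + 1) = h w * (2 + h' w)" if w: "w \<in> ball c r" for w
  proof -
    have "s w = 4 * h' w + 1 - h w" by (simp add: h'_def field_simps)
    then have "(4 * h' w + 1 - h w)\<^sup>2 = (h w)\<^sup>2 + 14 * h w + 1" using s(2)[OF w] by (simp add: \<Delta>_def)
    then have "8 * (h' w * (2 * h' w + 1)) = 8 * (h w * (2 + h' w))" by algebra
    then show ?thesis by simp
  qed
  have h'D: "norm (h' w) < 1" if w: "w \<in> ball c r" for w using blaschke_pre_disc[OF eq[OF w] hD[OF w]] .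
  show ?thesis
  proof
    show "h' holomorphic_on ball c r" unfolding h'_def[abs_def] by (intro holomorphic_intros h s) auto
    show "h' ` ball c r \<subseteq> ball 0 1" using h'D by auto
    show "h' b = z" by (simp add: h'_def s(3))
    show "blaschke (h' w) = h w" if "w \<in> ball c r" for w
      using eq[OF that] ne2[OF h'D[OF that]] by (simp add: blaschke_def field_simps)
  qed
qed

text \<open>The critical orbit stays in the negative real axis and never reaches the fixed point, so the Koenigs
coordinate does not vanish at the critical value.\<close>
lemma blaschke_crit_value_orbit: "\<exists>x::real. -1/2 < x \<and> x < 0 \<and> (blaschke ^^ n) blaschke_crit_value = of_real x"
proof (induction n)
  case 0
  have "sqrt 3 < sqrt ((7/4)\<^sup>2)" by (intro real_sqrt_less_mono) (simp add: power2_eq_square)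
  moreover have "sqrt ((13/8)\<^sup>2) < sqrt 3" by (intro real_sqrt_less_mono) (simp add: power2_eq_square)
  ultimately have "sqrt 3 < 7/4" "13/8 < sqrt 3" by simp_all
  then show ?case by (intro exI[of _ "4 * sqrt 3 - 7"]) (simp add: blaschke_crit_value_def)
next
  case (Suc n)
  then obtain x where x: "-1/2 < x" "x < 0" "(blaschke ^^ n) blaschke_crit_value = of_real x" by blast
  define t where "t = (2 * x + 1) / (2 + x)"
  have t: "0 < t" "t < 1" using x by (auto simp: t_def)
  have "x * t < 0" using x t by (simp add: mult_neg_pos)
  moreover have "x * t > x" using mult_strict_left_mono_neg[OF t(2) x(2)] by simp
  then have "x * t > -1/2" using x(1) by linarith
  moreover have "blaschke (of_real x) = of_real (x * t)" by (simp add: blaschke_def t_def)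
  ultimately show ?case using x by (intro exI[of _ "x * t"]) simp
qed

text \<open>Let \<open>\<phi>\<close> be the Koenigs coordinate and \<open>q = - \<phi> / \<phi> blaschke_crit_value\<close>. To construct a section over a
ball through \<open>z\<close>, shrink the ball by \<open>2 ^ n\<close> until \<open>\<phi>\<close> is invertible over it, and lift the inverse back
through \<open>n\<close> copies of the Blaschke product. A lift is obstructed only if some intermediate map takes the
critical value, which means that the ball contains \<open>-(2^k)\<close> for some \<open>k \<ge> 1\<close>.\<close>
theorem Koenigs_ball_sections:
  obtains q where "q holomorphic_on ball 0 1" "q 0 = 0"
    "ball_sections (ball 0 1 \<inter> q -` (- {- (2 ^ k) | k :: nat. k \<ge> 1})) q (- {- (2 ^ k) | k :: nat. k \<ge> 1})"
proof -
  obtain \<phi> where hol: "\<phi> holomorphic_on ball 0 1"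
    and lim: "\<And>z. norm z < 1 \<Longrightarrow> (\<lambda>n. 2 ^ n * (blaschke ^^ n) z) \<longlonglongrightarrow> \<phi> z"
    and fe: "\<And>z. norm z < 1 \<Longrightarrow> \<phi> (blaschke z) = \<phi> z / 2" and \<phi>0: "\<phi> 0 = 0" and d\<phi>: "deriv \<phi> 0 = 1"
    by (rule Koenigs_exists) (rule that; assumption)
  have c0: "(0::complex) \<in> ball 0 1" and dne: "deriv \<phi> 0 \<noteq> 0" by (simp_all add: d\<phi>)
  obtain \<delta> where \<delta>: "\<delta> > 0" "ball (0::complex) \<delta> \<subseteq> ball 0 1" "open (\<phi> ` ball 0 \<delta>)" "inj_on \<phi> (ball 0 \<delta>)"
    by (rule has_complex_derivative_locally_invertible[OF hol c0 open_ball dne]) (rule that; assumption)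
  obtain \<psi> where \<psi>: "\<psi> holomorphic_on \<phi> ` ball 0 \<delta>" "\<And>z. z \<in> ball 0 \<delta> \<Longrightarrow> \<psi> (\<phi> z) = z"
    by (rule holomorphic_has_inverse[OF holomorphic_on_subset[OF hol \<delta>(2)] open_ball \<delta>(4)]) (rule that; assumption)
  have "0 \<in> \<phi> ` ball 0 \<delta>" using \<phi>0 \<delta>(1) by (metis centre_in_ball image_eqI)
  then obtain e where e: "e > 0" "ball 0 e \<subseteq> \<phi> ` ball 0 \<delta>" using \<delta>(3) openE by blast
  have iter0: "\<forall>\<^sub>F n in sequentially. (blaschke ^^ n) z \<in> ball 0 \<delta>" if "norm z < 1" for z
  proof -
    define \<rho> where "\<rho> = (2 * norm z + 1) / (2 + norm z)"
    have "(\<lambda>n. \<rho> ^ n) \<longlonglongrightarrow> 0"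
      using blaschke_ratio_less_1[of "norm z"] that by (intro LIMSEQ_power_zero) (simp add: \<rho>_def)
    then have "(\<lambda>n. (blaschke ^^ n) z) \<longlonglongrightarrow> 0"
      by (rule Lim_null_comparison[rotated])
         (use blaschke_iter_le_geometric[of z "norm z"] that in \<open>simp add: \<rho>_def\<close>)
    then show ?thesis using topological_tendstoD[OF _ open_ball] \<delta>(1) centre_in_ball by blast
  qed
  have fen: "\<phi> ((blaschke ^^ n) z) = \<phi> z / 2 ^ n" if "norm z < 1" for n z
  proof (induction n)
    case (Suc n)
    have "norm ((blaschke ^^ n) z) < 1" using blaschke_iter_disc[OF that, of n] that by simp
    then show ?case using fe[of "(blaschke ^^ n) z"] Suc by simp
  qed simp
  obtain xv where xv: "- 1 / 2 < xv" "xv < 0" "blaschke_crit_value = of_real xv" using blaschke_crit_value_orbit[of 0] by auto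
  have cv1: "norm blaschke_crit_value < 1" unfolding xv(3) norm_of_real using xv(1,2) by linarith
  define \<kappa> where "\<kappa> = \<phi> blaschke_crit_value"
  have \<kappa>: "\<kappa> \<noteq> 0"
  proof
    assume "\<kappa> = 0"
    obtain n where n: "(blaschke ^^ n) blaschke_crit_value \<in> ball 0 \<delta>"
      using iter0[OF cv1] unfolding eventually_sequentially by blast
    have "\<phi> ((blaschke ^^ n) blaschke_crit_value) = \<phi> 0" using fen[OF cv1, of n] \<open>\<kappa> = 0\<close> \<phi>0 by (simp add: \<kappa>_def)
    then have "(blaschke ^^ n) blaschke_crit_value = 0" using inj_onD[OF \<delta>(4) _ n] \<delta>(1) by simp
    then show False using blaschke_crit_value_orbit[of n] by auto
  qed
  define q where "q z = - \<phi> z / \<kappa>" for z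
  have \<phi>q: "\<phi> z = - \<kappa> * q z" for z using \<kappa> by (simp add: q_def)
  define W where "W = - {- (2 ^ k) :: complex | k :: nat. k \<ge> 1}"
  have qhol: "q holomorphic_on ball 0 1" unfolding q_def[abs_def] using \<kappa> by (intro holomorphic_intros hol) auto
  have "ball_sections (ball 0 1 \<inter> q -` W) q W"
    unfolding ball_sections_def
  proof (intro conjI allI impI)
    show "q holomorphic_on ball 0 1 \<inter> q -` W" by (rule holomorphic_on_subset[OF qhol]) auto
    show "q ` (ball 0 1 \<inter> q -` W) \<subseteq> W" by blast
    fix c r z assume *: "ball c r \<subseteq> W \<and> z \<in> ball 0 1 \<inter> q -` W \<and> q z \<in> ball c r"
    then have z: "norm z < 1" "q z \<in> ball c r" by auto
    obtain R where R: "R > 0" "\<And>w. w \<in> ball c r \<Longrightarrow> norm (\<kappa> * w) \<le> R"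
    proof
      show "norm \<kappa> * (norm c + \<bar>r\<bar>) + 1 > 0" by (intro add_nonneg_pos mult_nonneg_nonneg) auto
      show "norm (\<kappa> * w) \<le> norm \<kappa> * (norm c + \<bar>r\<bar>) + 1" if "w \<in> ball c r" for w
      proof -
        have "norm w \<le> norm c + \<bar>r\<bar>" using that norm_triangle_ineq2[of w c] by (auto simp: dist_norm norm_minus_commute)
        then show ?thesis using mult_left_mono[of "norm w" "norm c + \<bar>r\<bar>" "norm \<kappa>"] by (simp add: norm_mult)
      qed
    qed
    have "(\<lambda>n. R * (1/2) ^ n) \<longlonglongrightarrow> R * 0" by (intro tendsto_intros LIMSEQ_power_zero) auto
    then have "\<forall>\<^sub>F n in sequentially. R * (1/2) ^ n < e" using e(1) by (intro order_tendstoD(2)) auto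
    then obtain n where n: "R * (1/2) ^ n < e" "(blaschke ^^ n) z \<in> ball 0 \<delta>"
      using eventually_conj[OF _ iter0[OF z(1)]] unfolding eventually_sequentially by blast
    have small: "- \<kappa> * w / 2 ^ n \<in> ball 0 e" if "w \<in> ball c r" for w
    proof -
      have "norm (- \<kappa> * w / 2 ^ n) = norm (\<kappa> * w) / 2 ^ n" by (simp add: norm_divide norm_power norm_mult)
      also have "\<dots> \<le> R / 2 ^ n" using R(2)[OF that] by (intro divide_right_mono) auto
      also have "\<dots> < e" using n(1) by (simp add: power_divide)
      finally show ?thesis by simp
    qed
    \<comment> \<open>downward induction: the inverse near \<open>0\<close> at level \<open>n\<close>, then one lift for each level\<close>
    have "\<exists>g. g holomorphic_on ball c r \<and> g ` ball c r \<subseteq> ball 0 1 \<and> g (q z) = (blaschke ^^ k) z \<and>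
            (\<forall>w\<in>ball c r. \<phi> (g w) = - \<kappa> * w / 2 ^ k)" if "k \<le> n" for k
      using that
    proof (induction k rule: inc_induct)
      case base
      have inim: "- \<kappa> * w / 2 ^ n \<in> \<phi> ` ball 0 \<delta>" if "w \<in> ball c r" for w using small[OF that] e(2) by blast
      have img: "\<psi> y \<in> ball 0 \<delta>" "\<phi> (\<psi> y) = y" if "y \<in> \<phi> ` ball 0 \<delta>" for y using that \<psi>(2) by auto
      have "(\<lambda>w. \<psi> (- \<kappa> * w / 2 ^ n)) holomorphic_on ball c r"
        by (intro holomorphic_on_compose_gen[of "\<lambda>w. - \<kappa> * w / 2 ^ n" _ \<psi> "\<phi> ` ball 0 \<delta>", unfolded o_def]
            holomorphic_intros \<psi>) (use inim in auto)
      moreover have "\<psi> (- \<kappa> * q z / 2 ^ n) = (blaschke ^^ n) z"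
        using \<psi>(2)[OF n(2)] fen[OF z(1), of n] by (simp add: \<phi>q)
      ultimately show ?case
        using img(1)[OF inim] img(2)[OF inim] \<delta>(2)
        by (intro exI[of _ "\<lambda>w. \<psi> (- \<kappa> * w / 2 ^ n)"]) blast
    next
      case (step k)
      then obtain g where g: "g holomorphic_on ball c r" "g ` ball c r \<subseteq> ball 0 1" "g (q z) = (blaschke ^^ Suc k) z"
            "\<And>w. w \<in> ball c r \<Longrightarrow> \<phi> (g w) = - \<kappa> * w / 2 ^ Suc k" by blast
      have ncv: "g w \<noteq> blaschke_crit_value" if w: "w \<in> ball c r" for w
      proof
        assume "g w = blaschke_crit_value"
        then have "\<kappa> = - \<kappa> * w / 2 ^ Suc k" using g(4)[OF w] by (simp add: \<kappa>_def)
        then have "\<kappa> * (2 ^ Suc k) = \<kappa> * (- w)" by (simp add: field_simps)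
        then have "2 ^ Suc k = - w" using \<kappa> mult_left_cancel by blast
        then have "w = - (2 ^ Suc k)" by (metis minus_minus)
        then have "w \<notin> W" unfolding W_def by force
        then show False using w * by blast
      qed
      have zk: "norm ((blaschke ^^ k) z) < 1" using blaschke_iter_disc[OF z(1), of k] z(1) by simp
      obtain h where h: "h holomorphic_on ball c r" "h ` ball c r \<subseteq> ball 0 1" "h (q z) = (blaschke ^^ k) z"
             "\<And>w. w \<in> ball c r \<Longrightarrow> blaschke (h w) = g w"
        using blaschke_lift_step[OF g(1,2) ncv z(2) zk, of thesis] g(3) by auto
      have "\<phi> (h w) = - \<kappa> * w / 2 ^ k" if w: "w \<in> ball c r" for w
      proof -
        have "norm (h w) < 1" using subsetD[OF h(2) imageI[OF w]] by simp
        then have "\<phi> (g w) = \<phi> (h w) / 2" using fe[of "h w"] h(4)[OF w] by simp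
        then show ?thesis using g(4)[OF w] by simp
      qed
      then show ?case using h by blast
    qed
    from this[of 0] obtain g where g: "g holomorphic_on ball c r" "g ` ball c r \<subseteq> ball 0 1" "g (q z) = z"
            "\<And>w. w \<in> ball c r \<Longrightarrow> \<phi> (g w) = - \<kappa> * w" by auto
    have qg: "q (g w) = w" if "w \<in> ball c r" for w using g(4)[OF that] \<kappa> by (simp add: q_def)
    have "g ` ball c r \<subseteq> ball 0 1 \<inter> q -` W" using g(2) qg * by force
    then show "\<exists>g. g holomorphic_on ball c r \<and> g ` ball c r \<subseteq> ball 0 1 \<inter> q -` W \<and>
             (\<forall>w\<in>ball c r. q (g w) = w) \<and> g (q z) = z"
      using g qg by blast
  qed
  moreover have "q 0 = 0" by (simp add: q_def \<phi>0)
  ultimately show ?thesis using that qhol unfolding W_def by blast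
qed

section \<open>The hyperbolic density as an extremal quantity\<close>

lemma universal_coveringD:
  assumes "holomorphic_universal_covering p D"
  shows "p holomorphic_on ball 0 1" "covering_space (ball 0 1) p D" "p ` ball 0 1 = D"
  using assms covering_space_imp_surjective unfolding holomorphic_universal_covering_def by blast+

lemma universal_covering_deriv_nonzero:
  assumes p: "holomorphic_universal_covering p D" and z: "z \<in> ball 0 1"
  shows "deriv p z \<noteq> 0"
proof -
  obtain T u q where T: "z \<in> T" "openin (top_of_set (ball 0 1)) T" "homeomorphism T u p q"
    using covering_space_local_homeomorphism[OF universal_coveringD(2)[OF p] z] by metis
  have T': "open T" "T \<subseteq> ball 0 1" using T(2) by (auto simp: openin_open_eq)
  have "inj_on p T" using T(3) by (metis homeomorphism_def inj_on_inverseI)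
  then show ?thesis
    using holomorphic_injective_imp_regular[OF holomorphic_on_subset[OF universal_coveringD(1)[OF p] T'(2)] T'(1) _ T(1)]
    by blast
qed

lemma universal_covering_recentre:
  assumes p: "holomorphic_universal_covering p D" and z: "norm z < 1"
  obtains f where "f holomorphic_on ball 0 1" "f ` ball 0 1 \<subseteq> D" "f 0 = p z"
    "norm (deriv f 0) = (1 - (norm z)\<^sup>2) * norm (deriv p z)"
proof
  define T where "T = Moebius_function 0 (- z)"
  have z': "norm (- z) < 1" using z by simp
  have T: "T holomorphic_on ball 0 1" "T ` ball 0 1 \<subseteq> ball 0 1"
    using Moebius_function_holomorphic[OF z'] Moebius_function_norm_lt_1[OF z'] by (auto simp: T_def)
  have T0: "T 0 = z" by (simp add: T_def Moebius_function_simple)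
  show "(p \<circ> T) holomorphic_on ball 0 1"
    by (rule holomorphic_on_compose_gen[OF T(1) universal_coveringD(1)[OF p] T(2)])
  show "(p \<circ> T) ` ball 0 1 \<subseteq> D" using T(2) universal_coveringD(3)[OF p] by (auto simp: image_comp[symmetric])
  show "(p \<circ> T) 0 = p z" by (simp add: T0)
  have 1: "(p has_field_derivative deriv p z) (at (T 0))"
    using universal_coveringD(1)[OF p] z by (auto simp: T0 intro: holomorphic_derivI)
  have 2: "(T has_field_derivative (1 - (norm z)\<^sup>2)) (at 0)"
    using Moebius_deriv_0[OF z'] by (simp add: T_def)
  have "deriv (p \<circ> T) 0 = deriv p z * of_real (1 - (norm z)\<^sup>2)"
    using DERIV_imp_deriv[OF DERIV_chain[OF 1 2]] .
  moreover have "(norm z)\<^sup>2 \<le> 1" using z by (simp add: power_le_one)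
  ultimately show "norm (deriv (p \<circ> T) 0) = (1 - (norm z)\<^sup>2) * norm (deriv p z)"
    by (simp only: norm_mult norm_of_real) simp
qed

text \<open>Lift \<open>f\<close> through the covering with \<open>0\<close> going to \<open>z\<close> and apply the Schwarz lemma to the lift.\<close>
lemma universal_covering_Schwarz:
  assumes p: "holomorphic_universal_covering p D" and z: "norm z < 1"
    and f: "f holomorphic_on ball 0 1" "f ` ball 0 1 \<subseteq> D" "f 0 = p z"
  shows "norm (deriv f 0) \<le> (1 - (norm z)\<^sup>2) * norm (deriv p z)"
proof -
  obtain F where F: "continuous_on (ball 0 1) F" "F \<in> ball 0 1 \<rightarrow> ball 0 1" "F 0 = z"
    and pF: "\<And>y. y \<in> ball 0 1 \<Longrightarrow> p (F y) = f y"
  proof (rule covering_space_lift_strong[OF universal_coveringD(2)[OF p], of z 0 "ball 0 1" f])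
    show "simply_connected (ball (0::complex) 1)" by (simp add: convex_imp_simply_connected)
    show "locally path_connected (ball (0::complex) 1)" by (simp add: convex_imp_locally_path_connected)
  qed (use z f in \<open>auto intro: holomorphic_on_imp_continuous_on\<close>)
  have Fhol: "F holomorphic_on ball 0 1"
    by (rule covering_space_lift_is_holomorphic[OF universal_coveringD(2)[OF p] open_ball
        universal_coveringD(1)[OF p] f(1) _ F(2,1) pF]) (use f(2) in auto)
  have FD: "norm (F y) < 1" if "norm y < 1" for y using F(2) that by auto
  define G where "G = Moebius_function 0 z \<circ> F"
  have z': "norm (- z) < 1" using z by simp
  have Ghol: "G holomorphic_on ball 0 1"
    unfolding G_def by (rule holomorphic_on_compose_gen[OF Fhol Moebius_function_holomorphic[OF z]]) (use F(2) in auto)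
  have G0: "G 0 = 0" by (simp add: G_def F(3) Moebius_function_eq_zero)
  have GD: "norm (G y) < 1" if "norm y < 1" for y
    using Moebius_function_norm_lt_1[OF z FD[OF that]] by (simp add: G_def)
  have dG: "norm (deriv G 0) \<le> 1"
    using Schwarz_Lemma(2)[OF Ghol G0 GD, of 0] by simp
  have FG: "F y = Moebius_function 0 (- z) (G y)" if "norm y < 1" for y
    using Moebius_function_compose[of "-z" z "F y"] z FD[OF that] by (simp add: G_def)
  have 1: "(p has_field_derivative deriv p z) (at (Moebius_function 0 (- z) (G 0)))"
    using universal_coveringD(1)[OF p] z by (auto simp: G0 Moebius_function_simple intro: holomorphic_derivI)
  have 2: "(Moebius_function 0 (- z) has_field_derivative (1 - (norm z)\<^sup>2)) (at (G 0))"
    using Moebius_deriv_0[OF z'] G0 by simp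
  have 3: "(G has_field_derivative deriv G 0) (at 0)"
    using Ghol by (auto intro: holomorphic_derivI)
  have "((\<lambda>y. p (Moebius_function 0 (- z) (G y))) has_field_derivative
          deriv p z * (of_real (1 - (norm z)\<^sup>2) * deriv G 0)) (at 0)"
    using DERIV_chain2[OF 1 DERIV_chain2[OF 2 3]] .
  then have "(f has_field_derivative deriv p z * (of_real (1 - (norm z)\<^sup>2) * deriv G 0)) (at 0)"
    by (rule has_field_derivative_transform_within_open[OF _ open_ball[of 0 1]]) (use FG pF in auto)
  then have "norm (deriv f 0) = norm (deriv p z) * (\<bar>1 - (norm z)\<^sup>2\<bar> * norm (deriv G 0))"
    by (simp only: DERIV_imp_deriv norm_mult norm_of_real)
  also have "\<dots> \<le> norm (deriv p z) * (\<bar>1 - (norm z)\<^sup>2\<bar> * 1)"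
    using dG by (intro mult_left_mono) auto
  also have "\<bar>1 - (norm z)\<^sup>2\<bar> = 1 - (norm z)\<^sup>2" using z by (simp add: power_le_one)
  finally show ?thesis by (simp add: mult.commute)
qed

text \<open>Two coverings dominate each other by the Schwarz lemma, so the defining condition has a unique solution.\<close>
lemma hyperbolic_density_eq:
  assumes p: "holomorphic_universal_covering p D" and z: "norm z < 1"
  shows "hyperbolic_density D (p z) = 1 / ((1 - (norm z)\<^sup>2) * norm (deriv p z))"
proof -
  have pos: "(1 - (norm z)\<^sup>2) > 0" if "norm z < 1" for z :: complex
    using that by (simp add: abs_square_less_1)
  have le: "(1 - (norm z2)\<^sup>2) * norm (deriv p2 z2) \<le> (1 - (norm z1)\<^sup>2) * norm (deriv p1 z1)"
    if 1: "holomorphic_universal_covering p1 D" "norm z1 < 1"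
      and 2: "holomorphic_universal_covering p2 D" "norm z2 < 1" and e: "p1 z1 = p2 z2" for p1 p2 z1 z2
    using universal_covering_recentre[OF 2] universal_covering_Schwarz[OF 1] e by metis
  define l where "l = 1 / ((1 - (norm z)\<^sup>2) * norm (deriv p z))"
  have nz: "deriv p z \<noteq> 0" using universal_covering_deriv_nonzero[OF p] z by simp
  show ?thesis
    unfolding hyperbolic_density_def l_def[symmetric]
  proof (rule the_equality, intro allI impI)
    fix p2 z2 assume *: "holomorphic_universal_covering p2 D \<and> z2 \<in> ball 0 1 \<and> p2 z2 = p z"
    then have z2: "norm z2 < 1" by simp
    have "(1 - (norm z2)\<^sup>2) * norm (deriv p2 z2) = (1 - (norm z)\<^sup>2) * norm (deriv p z)"
      using le[of p z p2 z2] le[of p2 z2 p z] * z z2 p by (intro order_antisym) auto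
    then have "l = 1 / ((1 - (norm z2)\<^sup>2) * norm (deriv p2 z2))" by (simp add: l_def)
    moreover have "deriv p2 z2 \<noteq> 0" using universal_covering_deriv_nonzero * by blast
    ultimately show "l * norm (deriv p2 z2) = 1 / (1 - (norm z2)\<^sup>2)" by simp
  next
    fix l' assume "\<forall>pa za. holomorphic_universal_covering pa D \<and> za \<in> ball 0 1 \<and> pa za = p z \<longrightarrow>
        l' * norm (deriv pa za) = 1 / (1 - (norm za)\<^sup>2)"
    then have "l' * norm (deriv p z) = 1 / (1 - (norm z)\<^sup>2)" using p z by simp
    then show "l' = l" using nz pos[OF z] by (simp add: l_def field_simps)
  qed
qed

lemma hyperbolic_density_pos:
  assumes p: "holomorphic_universal_covering p D" and w: "w \<in> D"
  shows "hyperbolic_density D w > 0"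
proof -
  obtain z where z: "norm z < 1" "w = p z" using universal_coveringD(3)[OF p] w by (metis imageE mem_ball_0)
  have "deriv p z \<noteq> 0" using universal_covering_deriv_nonzero[OF p] z(1) by simp
  then show ?thesis using z(1) unfolding z(2) hyperbolic_density_eq[OF p z(1)] by (simp add: abs_square_less_1)
qed

lemma hyperbolic_density_le:
  assumes p: "holomorphic_universal_covering p D"
    and f: "f holomorphic_on ball 0 1" "f ` ball 0 1 \<subseteq> D"
  shows "hyperbolic_density D (f 0) * norm (deriv f 0) \<le> 1"
proof -
  have "f 0 \<in> D" using f(2) by (auto simp: image_subset_iff)
  then obtain z where z: "norm z < 1" "f 0 = p z" using universal_coveringD(3)[OF p] by (metis imageE mem_ball_0)
  have "deriv p z \<noteq> 0" using universal_covering_deriv_nonzero[OF p] z(1) by simp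
  then have "(1 - (norm z)\<^sup>2) * norm (deriv p z) > 0" using z(1) by (simp add: abs_square_less_1)
  then show ?thesis
    using universal_covering_Schwarz[OF p z(1) f z(2)] unfolding z(2) hyperbolic_density_eq[OF p z(1)]
    by (simp add: field_simps)
qed

lemma hyperbolic_density_attained:
  assumes p: "holomorphic_universal_covering p D" and w: "w \<in> D"
  obtains f where "f holomorphic_on ball 0 1" "f ` ball 0 1 \<subseteq> D" "f 0 = w"
    "hyperbolic_density D w * norm (deriv f 0) = 1"
proof -
  obtain z where z: "norm z < 1" "w = p z" using universal_coveringD(3)[OF p] w by (metis imageE mem_ball_0)
  obtain f where f: "f holomorphic_on ball 0 1" "f ` ball 0 1 \<subseteq> D" "f 0 = p z"
    "norm (deriv f 0) = (1 - (norm z)\<^sup>2) * norm (deriv p z)"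
    using universal_covering_recentre[OF p z(1)] by metis
  have "deriv p z \<noteq> 0" using universal_covering_deriv_nonzero[OF p] z(1) by simp
  then have "(1 - (norm z)\<^sup>2) * norm (deriv p z) > 0" using z(1) by (simp add: abs_square_less_1)
  then have "hyperbolic_density D w * norm (deriv f 0) = 1"
    unfolding z(2) hyperbolic_density_eq[OF p z(1)] f(4)
    by (metis less_irrefl nonzero_eq_divide_eq)
  then show ?thesis using that f z by simp
qed

text \<open>Near the image of \<open>z\<close> the density is expressed through a holomorphic local inverse of the covering.\<close>
lemma hyperbolic_density_continuous:
  assumes p: "holomorphic_universal_covering p D" and D: "open D"
  shows "continuous_on D (hyperbolic_density D)"
proof (rule continuous_at_imp_continuous_on, rule ballI)
  fix w assume w: "w \<in> D"
  note hol = universal_coveringD(1)[OF p]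
  obtain z where z: "norm z < 1" "w = p z" using universal_coveringD(3)[OF p] w by (metis imageE mem_ball_0)
  have zb: "z \<in> ball 0 1" using z by simp
  obtain r where r: "r > 0" "ball z r \<subseteq> ball 0 1" "open (p ` ball z r)" "inj_on p (ball z r)"
    by (rule has_complex_derivative_locally_invertible[OF hol zb open_ball universal_covering_deriv_nonzero[OF p zb]])
       (rule that; assumption)
  obtain g where g: "g holomorphic_on p ` ball z r" "\<And>x. x \<in> ball z r \<Longrightarrow> g (p x) = x"
    by (rule holomorphic_has_inverse[OF holomorphic_on_subset[OF hol r(2)] open_ball r(4)]) (rule that; assumption)
  have gim: "g y \<in> ball z r" "p (g y) = y" if "y \<in> p ` ball z r" for y using that g(2) by auto
  have dens: "hyperbolic_density D y = 1 / ((1 - (norm (g y))\<^sup>2) * norm (deriv p (g y)))" if "y \<in> p ` ball z r" for y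
  proof -
    have "norm (g y) < 1" using gim(1)[OF that] r(2) by auto
    from hyperbolic_density_eq[OF p this] show ?thesis by (simp add: gim(2)[OF that])
  qed
  have "continuous_on (p ` ball z r) (\<lambda>y. 1 / ((1 - (norm (g y))\<^sup>2) * norm (deriv p (g y))))"
  proof (intro continuous_intros)
    show gc: "continuous_on (p ` ball z r) g" using g(1) by (rule holomorphic_on_imp_continuous_on)
    have "deriv p holomorphic_on ball 0 1" using hol by (rule holomorphic_deriv) simp
    then have "continuous_on (ball 0 1) (deriv p)" by (rule holomorphic_on_imp_continuous_on)
    then show "continuous_on (p ` ball z r) (\<lambda>y. deriv p (g y))"
      by (rule continuous_on_compose2[OF _ gc]) (use gim r(2) in blast)
    show "\<forall>y\<in>p ` ball z r. (1 - (norm (g y))\<^sup>2) * norm (deriv p (g y)) \<noteq> 0"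
    proof
      fix y assume "y \<in> p ` ball z r"
      then have gy: "g y \<in> ball 0 1" using gim(1) r(2) by blast
      then have "(norm (g y))\<^sup>2 < 1" by (simp add: abs_square_less_1)
      then show "(1 - (norm (g y))\<^sup>2) * norm (deriv p (g y)) \<noteq> 0"
        using universal_covering_deriv_nonzero[OF p gy] by simp
    qed
  qed
  then have "continuous_on (p ` ball z r) (hyperbolic_density D)"
    by (rule continuous_on_eq) (use dens in auto)
  moreover have "w \<in> p ` ball z r" using z(2) r(1) by auto
  ultimately show "isCont (hyperbolic_density D) w"
    using continuous_on_eq_continuous_at[OF r(3)] by blast
qed

lemma open_Omega_N: "open Omega_N"
proof -
  have "closed {- of_nat n :: complex | n :: nat. n \<ge> 1}"
    by (rule closed_subset_Ints) auto
  then show ?thesis unfolding Omega_N_def by auto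
qed

lemma connected_Omega_N: "connected Omega_N"
proof -
  have "countable {- of_nat n :: complex | n :: nat. n \<ge> 1}"
    by (rule countable_subset[of _ "range (\<lambda>n::nat. - of_nat n)"]) auto
  then show ?thesis
    unfolding Omega_N_def using path_connected_complement_countable[of "{- of_nat n :: complex | n :: nat. n \<ge> 1}"]
    by (simp add: path_connected_imp_connected Compl_eq_Diff_UNIV)
qed

lemma Omega_N_iff: "w \<in> Omega_N \<longleftrightarrow> (\<forall>n::nat. n \<ge> 1 \<longrightarrow> w \<noteq> - of_nat n)"
  unfolding Omega_N_def by auto

text \<open>Restricting the Koenigs covering to the preimage of \<open>Omega_N\<close> keeps the sections; the two omitted values
needed for normality are \<open>-1\<close> and \<open>-2\<close>.\<close>
lemma universal_covering_Omega_N: "\<exists>p. holomorphic_universal_covering p Omega_N"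
proof -
  define W where "W = - {- (2 ^ k) :: complex | k :: nat. k \<ge> 1}"
  obtain q where q: "q holomorphic_on ball 0 1" "q 0 = 0" "ball_sections (ball 0 1 \<inter> q -` W) q W"
    unfolding W_def by (rule Koenigs_ball_sections)
  have sub: "Omega_N \<subseteq> W"
  proof
    fix w assume w: "w \<in> Omega_N"
    have "w \<noteq> - (2 ^ k)" for k :: nat
      using w Omega_N_iff[of w] by (metis of_nat_numeral of_nat_power one_le_numeral one_le_power)
    then show "w \<in> W" by (auto simp: W_def)
  qed
  have eq: "ball 0 1 \<inter> q -` W \<inter> q -` Omega_N = ball 0 1 \<inter> q -` Omega_N" using sub by blast
  have "ball_sections (ball 0 1 \<inter> q -` Omega_N) q Omega_N"
    using ball_sections_subset[OF q(3) sub] unfolding eq .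
  then show ?thesis
  proof (rule universal_covering_exists[OF open_Omega_N connected_Omega_N, of "-1" "-2", rotated 3])
    show "open (ball 0 1 \<inter> q -` Omega_N)"
      by (rule continuous_open_preimage[OF holomorphic_on_imp_continuous_on[OF q(1)] open_ball open_Omega_N])
    show "0 \<in> ball 0 1 \<inter> q -` Omega_N" using q(2) by (simp add: Omega_N_iff)
    show "- 1 \<notin> Omega_N" using Omega_N_iff[of "-1"] by (metis of_nat_1 order_refl)
    show "- 2 \<notin> Omega_N" using Omega_N_iff[of "-2"] by (metis of_nat_numeral one_le_numeral)
  qed auto
qed

lemma Omega_N_add: "w \<in> Omega_N \<Longrightarrow> w + of_nat n \<in> Omega_N"
  unfolding Omega_N_iff
proof (intro allI impI notI)
  fix m :: nat
  assume *: "\<forall>n::nat. n \<ge> 1 \<longrightarrow> w \<noteq> - of_nat n" "m \<ge> 1" "w + of_nat n = - of_nat m"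
  then have "w = - of_nat (m + n)" by (simp add: algebra_simps)
  then show False using * by (metis trans_le_add1)
qed

text \<open>Translation by \<open>n\<close> maps \<open>Omega_N\<close> into itself, so it does not increase the density.\<close>
lemma hyperbolic_density_translate:
  assumes w: "w \<in> Omega_N"
  shows "hyperbolic_density Omega_N (w + of_nat n) \<le> hyperbolic_density Omega_N w"
proof -
  obtain p where p: "holomorphic_universal_covering p Omega_N" using universal_covering_Omega_N by blast
  obtain f where f: "f holomorphic_on ball 0 1" "f ` ball 0 1 \<subseteq> Omega_N" "f 0 = w"
    "hyperbolic_density Omega_N w * norm (deriv f 0) = 1"
    using hyperbolic_density_attained[OF p w] by metis
  have d: "deriv (\<lambda>z. f z + of_nat n) 0 = deriv f 0"
    using f(1) by (simp add: deriv_add holomorphic_on_imp_differentiable_at[OF _ open_ball])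
  have "hyperbolic_density Omega_N (w + of_nat n) * norm (deriv f 0) \<le> 1"
    using hyperbolic_density_le[OF p, of "\<lambda>z. f z + of_nat n"] f(1-3) Omega_N_add
    by (force simp: d intro!: holomorphic_intros)
  also have "1 = hyperbolic_density Omega_N w * norm (deriv f 0)" using f(4) by simp
  finally show ?thesis
    using f(4) by (metis mult_right_le_imp_le mult_zero_right norm_ge_zero order_less_le zero_neq_one)
qed

section \<open>Bounds for the hyperbolic density of the domain\<close>

text \<open>With \<open>s = csqrt (w + 1)\<close>, the map \<open>m\<close> sends the disc onto the right half-plane and \<open>0\<close> to \<open>s\<close>. Hence
\<open>m\<^sup>2 - 1\<close> is a conformal map onto the plane slit along \<open>x \<le> -1\<close>, with derivative of modulus
\<open>4 * |s| * Re s \<ge> 4 * (Re s)\<^sup>2 \<ge> 4 * (Re w + 1)\<close> at \<open>0\<close>.\<close>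
lemma hyperbolic_density_Omega_N_le:
  assumes w: "Re w > -1"
  shows "hyperbolic_density Omega_N w \<le> 1 / (4 * (Re w + 1))"
proof -
  obtain p where p: "holomorphic_universal_covering p Omega_N" using universal_covering_Omega_N by blast
  define s where "s = csqrt (w + 1)"
  have s2: "s\<^sup>2 = w + 1" by (simp add: s_def)
  have "Re w + 1 = (Re s)\<^sup>2 - (Im s)\<^sup>2"
    using arg_cong[OF s2, of Re] by (simp add: power2_eq_square)
  then have ws: "Re w + 1 \<le> (Re s)\<^sup>2" by simp
  then have "Re s \<noteq> 0" using w by auto
  moreover have "Re s \<ge> 0" unfolding s_def using csqrt_principal[of "w + 1"] by auto
  ultimately have Rs: "Re s > 0" by simp
  define m where "m z = \<i> * of_real (Im s) + of_real (Re s) * ((1 + z) / (1 - z))" for z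
  have ne: "1 - z \<noteq> 0" if "norm z < 1" for z :: complex using that by auto
  have Rem: "Re (m z) > 0" if z: "norm z < 1" for z
  proof -
    have "(norm z)\<^sup>2 < 1" using z by (simp add: abs_square_less_1)
    moreover have "Re ((1 + z) / (1 - z)) = (1 - (norm z)\<^sup>2) / (norm (1 - z))\<^sup>2"
      unfolding Re_divide' cmod_power2 by (simp add: power2_eq_square algebra_simps)
    ultimately have "Re ((1 + z) / (1 - z)) > 0" using ne[OF z] by simp
    moreover have "Re (m z) = Re s * Re ((1 + z) / (1 - z))"
      unfolding m_def plus_complex.sel times_complex.sel by simp
    ultimately show ?thesis using Rs by simp
  qed
  define f where "f z = (m z)\<^sup>2 - 1" for z
  have mhol: "m holomorphic_on ball 0 1" unfolding m_def[abs_def] by (intro holomorphic_intros) (use ne in auto)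
  then have fhol: "f holomorphic_on ball 0 1" unfolding f_def[abs_def] by (intro holomorphic_intros)
  have fD: "f z \<in> Omega_N" if z: "norm z < 1" for z
    unfolding Omega_N_iff
  proof (intro allI impI notI)
    fix n :: nat assume n: "n \<ge> 1" "f z = - of_nat n"
    then have e: "(m z)\<^sup>2 = 1 - of_nat n" by (simp add: f_def algebra_simps)
    have "2 * Re (m z) * Im (m z) = 0" using arg_cong[OF e, of Im] by (auto simp: power2_eq_square)
    then have "Im (m z) = 0" using Rem[OF z] by simp
    then have "(Re (m z))\<^sup>2 = 1 - real n" using arg_cong[OF e, of Re] by (simp add: power2_eq_square)
    moreover have "(Re (m z))\<^sup>2 > 0" using Rem[OF z] by simp
    ultimately show False using n(1) by simp
  qed
  have m0: "m 0 = s" by (simp add: m_def complex_eq_iff)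
  have dm: "(m has_field_derivative of_real (2 * Re s)) (at 0)"
    unfolding m_def[abs_def] by (auto intro!: derivative_eq_intros)
  have "(f has_field_derivative 2 * s * of_real (2 * Re s)) (at 0)"
    unfolding f_def[abs_def] by (rule derivative_eq_intros dm refl)+ (simp add: m0)
  then have "deriv f 0 = 2 * s * of_real (2 * Re s)" by (rule DERIV_imp_deriv)
  then have "norm (deriv f 0) = 4 * (norm s * Re s)"
    using Rs by (simp only: norm_mult norm_of_real) simp
  also have "\<dots> \<ge> 4 * (Re w + 1)"
    using ws mult_right_mono[OF complex_Re_le_cmod[of s] less_imp_le[OF Rs]] by (simp add: power2_eq_square)
  finally have df: "norm (deriv f 0) \<ge> 4 * (Re w + 1)" .
  have f0: "f 0 = w" by (simp add: f_def m0 s2)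
  have fim: "f ` ball 0 1 \<subseteq> Omega_N" using fD by (simp add: image_subset_iff)
  have "hyperbolic_density Omega_N w * norm (deriv f 0) \<le> 1"
    using hyperbolic_density_le[OF p fhol fim] unfolding f0 .
  moreover have "w \<in> Omega_N" using fD[of 0] f0 by simp
  then have "hyperbolic_density Omega_N w > 0" using hyperbolic_density_pos[OF p] by blast
  ultimately have "hyperbolic_density Omega_N w * (4 * (Re w + 1)) \<le> 1"
    using mult_left_mono[OF df, of "hyperbolic_density Omega_N w"] by linarith
  then show ?thesis using w by (simp add: field_simps)
qed

text \<open>The Schwarz lemma transported by the Cayley transform that sends \<open>s 0\<close> to \<open>0\<close>.\<close>
lemma right_half_plane_Schwarz:
  assumes s: "s holomorphic_on ball 0 1" "\<And>z. norm z < 1 \<Longrightarrow> Re (s z) > 0"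
  shows "norm (deriv s 0) \<le> 2 * Re (s 0)"
proof -
  define a where "a = s 0"
  have a: "Re a > 0" using s(2)[of 0] by (simp add: a_def)
  have ne: "s z + cnj a \<noteq> 0" if "norm z < 1" for z
    using s(2)[OF that] a by (auto simp: complex_eq_iff)
  define c where "c z = (s z - a) / (s z + cnj a)" for z
  have chol: "c holomorphic_on ball 0 1" unfolding c_def[abs_def] by (intro holomorphic_intros s(1)) (use ne in auto)
  have c0: "c 0 = 0" by (simp add: c_def a_def)
  have cD: "norm (c z) < 1" if z: "norm z < 1" for z
  proof -
    have "(norm (s z + cnj a))\<^sup>2 - (norm (s z - a))\<^sup>2 = 4 * Re (s z) * Re a"
      unfolding cmod_power2 by (simp add: power2_eq_square algebra_simps)
    also have "\<dots> > 0" using s(2)[OF z] a by simp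
    finally have "norm (s z - a) < norm (s z + cnj a)" by (intro power2_less_imp_less[of "norm (s z - a)"]) auto
    then show ?thesis using ne[OF z] by (simp add: c_def norm_divide)
  qed
  have le: "norm (deriv c 0) \<le> 1" using Schwarz_Lemma(2)[OF chol c0 cD, of 0] by simp
  have ds: "(s has_field_derivative deriv s 0) (at 0)" using s(1) by (auto intro: holomorphic_derivI)
  have aa: "a + cnj a = of_real (2 * Re a)" by (simp add: complex_eq_iff)
  have "(c has_field_derivative (deriv s 0 * (s 0 + cnj a) - (s 0 - a) * deriv s 0) / ((s 0 + cnj a) * (s 0 + cnj a))) (at 0)"
    unfolding c_def[abs_def] by (rule derivative_eq_intros ds refl | use ne[of 0] in simp)+
  then have "(c has_field_derivative deriv s 0 / of_real (2 * Re a)) (at 0)"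
    using a by (simp add: a_def[symmetric] aa del: of_real_mult)
  then have "norm (deriv c 0) = norm (deriv s 0) / (2 * Re a)"
    using a by (simp add: DERIV_imp_deriv norm_divide del: of_real_mult)
  then show ?thesis using le a by (simp add: a_def field_simps)
qed

text \<open>The principal square root of \<open>- H\<close> takes values in the right half-plane.\<close>
lemma slit_plane_Schwarz:
  assumes H: "H holomorphic_on ball 0 1" "\<And>z x. norm z < 1 \<Longrightarrow> 0 \<le> x \<Longrightarrow> H z \<noteq> complex_of_real x"
  shows "norm (deriv H 0) \<le> 4 * norm (H 0)"
proof -
  define s where "s z = csqrt (- H z)" for z
  have np: "- H z \<notin> \<real>\<^sub>\<le>\<^sub>0" if "norm z < 1" for z
  proof
    assume "- H z \<in> \<real>\<^sub>\<le>\<^sub>0"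
    then have "H z \<in> \<real>\<^sub>\<ge>\<^sub>0" by simp
    then show False using H(2)[OF that] by (metis nonneg_Reals_cases)
  qed
  have shol: "s holomorphic_on ball 0 1" unfolding s_def[abs_def]
    by (rule holomorphic_on_csqrt') (use np H(1) in \<open>auto intro!: holomorphic_intros\<close>)
  have s2: "H z = - (s z)\<^sup>2" for z by (simp add: s_def)
  have Rs: "Re (s z) > 0" if "norm z < 1" for z
  proof (rule ccontr)
    assume "\<not> Re (s z) > 0"
    moreover have "Re (s z) \<ge> 0" unfolding s_def using csqrt_principal[of "- H z"] by auto
    ultimately have "Re (s z) = 0" by simp
    then have "H z = of_real ((Im (s z))\<^sup>2)" unfolding s2 by (simp add: complex_eq_iff power2_eq_square)
    then show False using H(2)[OF that] by (metis zero_le_power2)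
  qed
  have ds: "(s has_field_derivative deriv s 0) (at 0)" using shol by (auto intro: holomorphic_derivI)
  have "(H has_field_derivative - (2 * s 0 * deriv s 0)) (at 0)"
    unfolding s2 by (rule derivative_eq_intros ds refl)+ simp
  then have "norm (deriv H 0) = 2 * norm (s 0) * norm (deriv s 0)"
    by (simp add: DERIV_imp_deriv norm_mult)
  also have "\<dots> \<le> 2 * norm (s 0) * (2 * Re (s 0))"
    using right_half_plane_Schwarz[OF shol Rs] by (intro mult_left_mono) auto
  also have "\<dots> \<le> 2 * norm (s 0) * (2 * norm (s 0))"
    using complex_Re_le_cmod by (intro mult_left_mono) auto
  also have "\<dots> = 4 * norm (H 0)" unfolding s2 norm_minus_cancel norm_power by (simp add: power2_eq_square)
  finally show ?thesis .
qed

text \<open>The statement combines an asymptotic bound \<open>(4 + \<epsilon>) * |f 0|\<close> for large \<open>|f 0|\<close> with a constant bound for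
bounded \<open>|f 0|\<close>; the form \<open>sqrt (|f 0|\<^sup>2 + K\<^sup>2)\<close> is smooth in \<open>f 0\<close>, which matters when it is integrated
along curves. If it failed for every \<open>K\<close>, counterexamples \<open>f k\<close> divided by \<open>- m k\<close>, where \<open>m k\<close> is
\<open>R k\<close> rounded up, would omit all positive integer multiples of \<open>1 / m k\<close>, and a limit would omit the closed positive axis
while having a derivative at \<open>0\<close> larger than \<open>4\<close> and a value there of modulus at most \<open>1\<close>.\<close>
lemma Omega_N_asymptotic_Schwarz:
  assumes \<epsilon>: "\<epsilon> > 0"
  obtains K :: real where "K \<ge> 1"
    "\<And>f. \<lbrakk>f holomorphic_on ball 0 1; f ` ball 0 1 \<subseteq> Omega_N\<rbrakk> \<Longrightarrow>
        norm (deriv f 0) \<le> (4 + \<epsilon>) * sqrt ((norm (f 0))\<^sup>2 + K\<^sup>2)"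
proof -
  have "\<exists>K\<ge>1. \<forall>f. f holomorphic_on ball 0 1 \<longrightarrow> f ` ball 0 1 \<subseteq> Omega_N \<longrightarrow>
        norm (deriv f 0) \<le> (4 + \<epsilon>) * sqrt ((norm (f 0))\<^sup>2 + K\<^sup>2)"
  proof (rule ccontr)
    assume "\<not> ?thesis"
    then have "\<forall>k::nat. \<exists>f. f holomorphic_on ball 0 1 \<and> f ` ball 0 1 \<subseteq> Omega_N \<and>
        norm (deriv f 0) > (4 + \<epsilon>) * sqrt ((norm (f 0))\<^sup>2 + (real (Suc k))\<^sup>2)"
      by (metis not_le of_nat_1 of_nat_le_iff le_add1 plus_1_eq_Suc)
    then obtain f where f: "\<And>k::nat. f k holomorphic_on ball 0 1" "\<And>k. f k ` ball 0 1 \<subseteq> Omega_N"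
        "\<And>k. norm (deriv (f k) 0) > (4 + \<epsilon>) * sqrt ((norm (f k 0))\<^sup>2 + (real (Suc k))\<^sup>2)"
      by metis
    define R where "R k = sqrt ((norm (f k 0))\<^sup>2 + (real (Suc k))\<^sup>2)" for k
    have Rk: "real (Suc k) \<le> R k" "norm (f k 0) \<le> R k" for k
      unfolding R_def by (auto intro: real_le_rsqrt)
    define m where "m k = nat \<lceil>R k\<rceil>" for k
    have m: "R k \<le> real (m k)" "real (m k) \<le> R k + 1" for k
      using Rk(1)[of k] unfolding m_def by (linarith, linarith)
    have mk: "real (Suc k) \<le> real (m k)" "m k > 0" for k
      using Rk(1)[of k] m(1)[of k] by (linarith, linarith)
    have inv0: "(\<lambda>k. 1 / real (m k)) \<longlonglongrightarrow> 0"
    proof (rule tendsto_sandwich[of "\<lambda>_. 0" _ _ "\<lambda>k. inverse (real (Suc k))"])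
      show "\<forall>\<^sub>F k in sequentially. 1 / real (m k) \<le> inverse (real (Suc k))"
        using mk by (intro always_eventually allI) (simp add: inverse_eq_divide frac_le)
    qed (use LIMSEQ_inverse_real_of_nat in auto)
    define H where "H k z = - f k z / of_nat (m k)" for k z
    have Hhol: "H k holomorphic_on ball 0 1" for k
      unfolding H_def[abs_def] by (intro holomorphic_intros f(1)) (use mk(2)[of k] in auto)
    have Homit: "H k z \<noteq> of_nat j / of_nat (m k)" if "norm z < 1" "j \<ge> 1" for k z j
    proof
      assume "H k z = of_nat j / of_nat (m k)"
      then have "- f k z = of_nat j" unfolding H_def using mk(2)[of k]
        by (metis divide_cancel_right less_irrefl of_nat_eq_0_iff)
      then have "f k z = - of_nat j" by (simp add: minus_equation_iff)
      moreover have "f k z \<in> Omega_N" using f(2)[of k] that(1) by auto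
      ultimately show False using that(2) Omega_N_iff by blast
    qed
    have H0: "norm (H k 0) \<le> 1" for k
      using Rk(2)[of k] m(1)[of k] mk(2)[of k] by (simp add: H_def norm_divide)
    have dH: "norm (deriv (H k) 0) \<ge> (4 + \<epsilon>) * (1 - 1 / real (m k))" for k
    proof -
      have "(f k has_field_derivative deriv (f k) 0) (at 0)" 
        using holomorphic_derivI[OF f(1) open_ball, of 0] by simp
      then have "(H k has_field_derivative - deriv (f k) 0 / of_nat (m k)) (at 0)"
        unfolding H_def[abs_def] by (intro DERIV_cdivide DERIV_minus)
      then have "norm (deriv (H k) 0) = norm (deriv (f k) 0) / real (m k)"
        by (simp add: DERIV_imp_deriv norm_divide)
      also have "\<dots> \<ge> (4 + \<epsilon>) * R k / real (m k)"
        using f(3)[of k] by (intro divide_right_mono) (auto simp: R_def)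
      finally have "norm (deriv (H k) 0) \<ge> (4 + \<epsilon>) * (R k / real (m k))" by simp
      moreover have "1 - 1 / real (m k) \<le> R k / real (m k)"
      proof -
        have "1 - 1 / real (m k) = (real (m k) - 1) / real (m k)" using mk(2)[of k] by (simp add: diff_divide_distrib)
        also have "\<dots> \<le> R k / real (m k)" using m(2)[of k] by (intro divide_right_mono) auto
        finally show ?thesis .
      qed
      then have "(4 + \<epsilon>) * (1 - 1 / real (m k)) \<le> (4 + \<epsilon>) * (R k / real (m k))"
        using \<epsilon> by (intro mult_left_mono) auto
      ultimately show ?thesis by linarith
    qed
    obtain g r where g: "g holomorphic_on ball 0 1" and r: "strict_mono (r :: nat \<Rightarrow> nat)"
      and lim: "\<And>K. \<lbrakk>compact K; K \<subseteq> ball 0 1\<rbrakk> \<Longrightarrow> uniform_limit K (H \<circ> r) g sequentially"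
    proof (rule Montel_omitting[of H 1 2 1])
      show "H n z \<noteq> 1 \<and> H n z \<noteq> 2" if "z \<in> ball 0 1" for n z
        using Homit[of z "m n" n] Homit[of z "2 * m n" n] that mk(2)[of n] by auto
    qed (use Hhol H0 in auto)
    have gc: "continuous_on (ball 0 1) g" using g by (rule holomorphic_on_imp_continuous_on)
    have invr: "(\<lambda>k. 1 / real (m (r k))) \<longlonglongrightarrow> 0" using LIMSEQ_subseq_LIMSEQ[OF inv0 r] by (simp add: o_def)
    have g0: "norm (g 0) \<le> 1"
    proof (rule LIMSEQ_le_const2)
      show "(\<lambda>n. norm ((H \<circ> r) n 0)) \<longlonglongrightarrow> norm (g 0)"
        using uniform_limit_along[OF open_ball _ gc lim, of 0 "\<lambda>_. 0"] by (intro tendsto_norm) simp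
    qed (use H0 in auto)
    have dg: "4 + \<epsilon> \<le> norm (deriv g 0)"
    proof (rule LIMSEQ_le)
      have "(\<lambda>k. (4 + \<epsilon>) * (1 - 1 / real (m (r k)))) \<longlonglongrightarrow> (4 + \<epsilon>) * (1 - 0)"
        by (intro tendsto_intros invr)
      then show "(\<lambda>k. (4 + \<epsilon>) * (1 - 1 / real (m (r k)))) \<longlonglongrightarrow> 4 + \<epsilon>" by simp
      show "(\<lambda>n. norm (deriv ((H \<circ> r) n) 0)) \<longlonglongrightarrow> norm (deriv g 0)"
        using uniform_limit_deriv[of "ball 0 1" 0 "H \<circ> r" g] lim Hhol by (intro tendsto_norm) simp
    qed (use dH in auto)
    have nonconst: "\<not> g constant_on ball 0 1"
    proof
      assume "g constant_on ball 0 1"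
      then obtain c where c: "\<And>z. z \<in> ball 0 1 \<Longrightarrow> g z = c" by (auto simp: constant_on_def)
      have "(g has_field_derivative 0) (at 0)"
        using has_field_derivative_transform_within_open[of "\<lambda>_. c" 0 0 "ball 0 1" g] c by auto
      then show False using dg \<epsilon> DERIV_imp_deriv by fastforce
    qed
    \<comment> \<open>the omitted values \<open>y k\<close> approximate \<open>x\<close>\<close>
    have gpos: "g z \<noteq> of_real x" if z: "norm z < 1" and x: "x > 0" for z x
    proof -
      define j where "j k = nat \<lceil>x * real (m (r k))\<rceil>" for k
      define y where "y k = real (j k) / real (m (r k))" for k
      have j: "x * real (m (r k)) \<le> real (j k)" "real (j k) \<le> x * real (m (r k)) + 1" for k
      proof -
        have "x * real (m (r k)) > 0" using x mk(2)[of "r k"] by simp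
        then show "x * real (m (r k)) \<le> real (j k)" "real (j k) \<le> x * real (m (r k)) + 1"
          unfolding j_def by (linarith, linarith)
      qed
      have j1: "j k \<ge> 1" for k
      proof -
        have "x * real (m (r k)) > 0" using x mk(2)[of "r k"] by simp
        then show ?thesis using j(1)[of k] by linarith
      qed
      have y: "x \<le> y k" "y k \<le> x + 1 / real (m (r k))" for k
        
      proof -
        have mp: "real (m (r k)) > 0" using mk(2)[of "r k"] by simp
        show "x \<le> y k" using j(1)[of k] mp by (simp add: y_def pos_le_divide_eq)
        have "y k \<le> (x * real (m (r k)) + 1) / real (m (r k))"
          unfolding y_def using j(2)[of k] mp by (intro divide_right_mono) auto
        also have "\<dots> = x + 1 / real (m (r k))" using mp by (simp add: add_divide_distrib)
        finally show "y k \<le> x + 1 / real (m (r k))" .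
      qed
      have "(\<lambda>k. x + 1 / real (m (r k))) \<longlonglongrightarrow> x + 0" by (intro tendsto_intros invr)
      then have ylim: "y \<longlonglongrightarrow> x"
        using tendsto_sandwich[of "\<lambda>_. x" y sequentially "\<lambda>k. x + 1 / real (m (r k))" x] y by simp
      have "g z - of_real x \<noteq> 0"
      proof (rule Hurwitz_no_zeros[of "ball 0 1" "\<lambda>n u. H (r n) u - of_real (y n)" "\<lambda>u. g u - of_real x"])
        show "\<not> (\<lambda>u. g u - of_real x) constant_on ball 0 1"
          using nonconst unfolding constant_on_def by (metis diff_add_cancel)
        show "uniform_limit K (\<lambda>n u. H (r n) u - of_real (y n)) (\<lambda>u. g u - of_real x) sequentially"
          if "compact K" "K \<subseteq> ball 0 1" for K
        proof (rule uniform_limit_minus)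
          show "uniform_limit K (\<lambda>n. H (r n)) g sequentially" using lim[OF that] by (simp add: o_def)
          have "(\<lambda>n. complex_of_real (y n)) \<longlonglongrightarrow> of_real x" using ylim by (rule tendsto_of_real)
          then show "uniform_limit K (\<lambda>n u. complex_of_real (y n)) (\<lambda>u. of_real x) sequentially"
            by (auto simp: uniform_limit_iff tendsto_iff elim: eventually_mono)
        qed
        show "H (r n) u - of_real (y n) \<noteq> 0" if "u \<in> ball 0 1" for n u
          using Homit[of u "j n" "r n"] j1 that by (simp add: y_def)
      qed (use z Hhol g in \<open>auto intro!: holomorphic_intros\<close>)
      then show ?thesis by simp
    qed
    \<comment> \<open>the image is open, so with \<open>0\<close> it would contain small positive numbers\<close>
    have gnz: "g z \<noteq> 0" if z: "norm z < 1" for z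
    proof
      assume gz: "g z = 0"
      have "open (g ` ball 0 1)"
        using open_mapping_thm[OF g open_ball connected_ball open_ball order_refl nonconst] .
      moreover have "0 \<in> g ` ball 0 1" using gz z by (metis image_eqI mem_ball_0)
      ultimately obtain e where e: "e > 0" "ball 0 e \<subseteq> g ` ball 0 1" using openE by blast
      have "complex_of_real (e / 2) \<in> ball 0 e" using e(1) by simp
      then obtain u where "norm u < 1" "g u = of_real (e / 2)" using e(2) by (metis (no_types, lifting) imageE mem_ball_0 subsetD)
      then show False using gpos[of u "e / 2"] e(1) by simp
    qed
    have "norm (deriv g 0) \<le> 4 * norm (g 0)"
    proof (rule slit_plane_Schwarz[OF g])
      fix z x assume "norm (z::complex) < 1" "0 \<le> (x::real)"
      then show "g z \<noteq> of_real x" using gpos[of z x] gnz[of z] by (cases "x = 0") auto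
    qed
    then show False using g0 dg \<epsilon> by linarith
  qed
  then show ?thesis using that by blast
qed

lemma hyperbolic_density_Omega_N_ge:
  assumes \<epsilon>: "\<epsilon> > 0"
  obtains K :: real where "K \<ge> 1"
    "\<And>w. w \<in> Omega_N \<Longrightarrow> 1 \<le> (4 + \<epsilon>) * sqrt ((norm w)\<^sup>2 + K\<^sup>2) * hyperbolic_density Omega_N w"
proof -
  obtain p where p: "holomorphic_universal_covering p Omega_N" using universal_covering_Omega_N by blast
  obtain K where K: "K \<ge> 1" "\<And>f. \<lbrakk>f holomorphic_on ball 0 1; f ` ball 0 1 \<subseteq> Omega_N\<rbrakk> \<Longrightarrow>
        norm (deriv f 0) \<le> (4 + \<epsilon>) * sqrt ((norm (f 0))\<^sup>2 + K\<^sup>2)"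
    using Omega_N_asymptotic_Schwarz[OF \<epsilon>] by metis
  have "1 \<le> (4 + \<epsilon>) * sqrt ((norm w)\<^sup>2 + K\<^sup>2) * hyperbolic_density Omega_N w" if w: "w \<in> Omega_N" for w
  proof -
    obtain f where f: "f holomorphic_on ball 0 1" "f ` ball 0 1 \<subseteq> Omega_N" "f 0 = w"
      "hyperbolic_density Omega_N w * norm (deriv f 0) = 1"
      using hyperbolic_density_attained[OF p w] by metis
    have "norm (deriv f 0) \<le> (4 + \<epsilon>) * sqrt ((norm w)\<^sup>2 + K\<^sup>2)" using K(2)[OF f(1,2)] f(3) by simp
    then have "hyperbolic_density Omega_N w * norm (deriv f 0) \<le> hyperbolic_density Omega_N w * ((4 + \<epsilon>) * sqrt ((norm w)\<^sup>2 + K\<^sup>2))"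
      using hyperbolic_density_pos[OF p w] by (intro mult_left_mono) auto
    then show ?thesis unfolding f(4) by (simp add: mult_ac)
  qed
  then show ?thesis using that K(1) by blast
qed

section \<open>Hyperbolic length of piecewise smooth curves\<close>

text \<open>An additive property of intervals that holds between neighbouring points of a finite set holds between any
two of its points.\<close>
lemma finite_partition_induct:
  fixes S :: "real set"
  assumes S: "finite S" "a \<in> S" "b \<in> S" "a < b"
    and gap: "\<And>a b. \<lbrakk>a \<in> S; b \<in> S; a < b; {a<..<b} \<inter> S = {}\<rbrakk> \<Longrightarrow> P a b"
    and join: "\<And>a c b. \<lbrakk>a \<in> S; c \<in> S; b \<in> S; a < c; c < b; P a c; P c b\<rbrakk> \<Longrightarrow> P a b"
  shows "P a b"
  using S(2-)
proof (induction "card ({a<..<b} \<inter> S)" arbitrary: a b rule: less_induct)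
  case less
  show ?case
  proof (cases "{a<..<b} \<inter> S = {}")
    case True then show ?thesis using gap less by blast
  next
    case False
    then obtain c where c: "c \<in> S" "a < c" "c < b" by auto
    have fin: "finite ({a<..<b} \<inter> S)" using S(1) by blast
    have "{a<..<c} \<inter> S \<subset> {a<..<b} \<inter> S" "{c<..<b} \<inter> S \<subset> {a<..<b} \<inter> S"
      using c by (auto simp: psubset_eq set_eq_iff intro: exI[of _ c])
    then have "card ({a<..<c} \<inter> S) < card ({a<..<b} \<inter> S)" "card ({c<..<b} \<inter> S) < card ({a<..<b} \<inter> S)"
      using fin by (auto intro: psubset_card_mono)
    then show ?thesis using less c join[of a c b] by blast
  qed
qed

definition C1_piece :: "(real \<Rightarrow> complex) \<Rightarrow> real \<Rightarrow> real \<Rightarrow> bool" where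
  "C1_piece g a b \<longleftrightarrow> (\<exists>g'. continuous_on {a..b} g' \<and>
     (\<forall>t\<in>{a..b}. (g has_vector_derivative g' t) (at t within {a..b})))"

lemma piecewise_C1_curve_iff:
  "piecewise_C1_curve g \<longleftrightarrow> path g \<and> (\<exists>S. finite S \<and> {0, 1} \<subseteq> S \<and> S \<subseteq> {0..1} \<and>
     (\<forall>a\<in>S. \<forall>b\<in>S. a < b \<and> {a<..<b} \<inter> S = {} \<longrightarrow> C1_piece g a b))"
  by (simp add: piecewise_C1_curve_def C1_piece_def)

lemma piecewise_C1_curveE:
  assumes "piecewise_C1_curve g"
  obtains S where "finite S" "{0, 1} \<subseteq> S" "S \<subseteq> {0..1}"
    "\<And>a b. \<lbrakk>a \<in> S; b \<in> S; a < b; {a<..<b} \<inter> S = {}\<rbrakk> \<Longrightarrow> C1_piece g a b"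
proof -
  obtain S where S: "finite S \<and> {0, 1} \<subseteq> S \<and> S \<subseteq> {0..1} \<and>
     (\<forall>a\<in>S. \<forall>b\<in>S. a < b \<and> {a<..<b} \<inter> S = {} \<longrightarrow> C1_piece g a b)"
    using assms unfolding piecewise_C1_curve_iff by (elim conjE exE) (rule that, intro conjI)
  show ?thesis by (rule that[of S]) (use S in simp_all)
qed

lemma piecewise_C1_induct:
  assumes g: "piecewise_C1_curve g"
    and piece: "\<And>a b. \<lbrakk>0 \<le> a; a < b; b \<le> 1; C1_piece g a b\<rbrakk> \<Longrightarrow> P a b"
    and join: "\<And>a c b. \<lbrakk>0 \<le> a; a < c; c < b; b \<le> 1; P a c; P c b\<rbrakk> \<Longrightarrow> P a b"
  shows "P 0 1"
proof -
  obtain S where S: "finite S" "{0, 1} \<subseteq> S" "S \<subseteq> {0..1}"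
    "\<And>a b. \<lbrakk>a \<in> S; b \<in> S; a < b; {a<..<b} \<inter> S = {}\<rbrakk> \<Longrightarrow> C1_piece g a b"
    by (rule piecewise_C1_curveE[OF g]) (rule that; assumption)
  have S01: "0 \<le> x" "x \<le> 1" if "x \<in> S" for x using S(3) that by auto
  show ?thesis
  proof (rule finite_partition_induct[OF S(1), of 0 1 P])
    show "P a b" if "a \<in> S" "b \<in> S" "a < b" "{a<..<b} \<inter> S = {}" for a b
      using piece[of a b] S(4)[OF that] S01 that by blast
    show "P a b" if "a \<in> S" "c \<in> S" "b \<in> S" "a < c" "c < b" "P a c" "P c b" for a b c
      using join[of a c b] S01 that by blast
  qed (use S(2) in auto)
qed

lemma C1_piece_interior_derivative:
  assumes "(g has_vector_derivative g') (at t within {a..b})" "a < t" "t < b" "0 \<le> a" "b \<le> (1::real)"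
  shows "(g has_vector_derivative g') (at t)" "vector_derivative g (at t within {0..1}) = g'"
proof -
  show 1: "(g has_vector_derivative g') (at t)"
    using assms(1-3) by (metis at_within_Icc_at)
  show "vector_derivative g (at t within {0..1}) = g'"
    using vector_derivative_at_within_ivl[OF 1] assms by auto
qed

definition speed :: "complex set \<Rightarrow> (real \<Rightarrow> complex) \<Rightarrow> real \<Rightarrow> real" where
  "speed D g t = hyperbolic_density D (g t) * norm (vector_derivative g (at t within {0..1}))"

lemma C1_piece_speed:
  assumes cont: "continuous_on D (hyperbolic_density D)" and g: "g ` {0..1} \<subseteq> D"
    and ab: "0 \<le> a" "a < b" "b \<le> 1"
    and g': "continuous_on {a..b} g'" "\<And>t. t \<in> {a..b} \<Longrightarrow> (g has_vector_derivative g' t) (at t within {a..b})"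
  shows "(\<lambda>t. hyperbolic_density D (g t) * norm (g' t)) integrable_on {a..b}"
    "(speed D g has_integral (integral {a..b} (\<lambda>t. hyperbolic_density D (g t) * norm (g' t)))) {a..b}"
proof -
  have gc: "continuous_on {a..b} g"
    using g'(2) by (meson has_vector_derivative_continuous continuous_on_eq_continuous_within)
  have "g ` {a..b} \<subseteq> D" using g ab by (meson atLeastatMost_subset_iff image_mono order_trans)
  then have "continuous_on {a..b} (\<lambda>t. hyperbolic_density D (g t) * norm (g' t))"
    by (intro continuous_intros continuous_on_compose2[OF cont gc] g'(1)) 
  then show int: "(\<lambda>t. hyperbolic_density D (g t) * norm (g' t)) integrable_on {a..b}"
    by (rule integrable_continuous_real)
  show "(speed D g has_integral (integral {a..b} (\<lambda>t. hyperbolic_density D (g t) * norm (g' t)))) {a..b}"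
  proof (rule has_integral_spike_finite[OF _ _ integrable_integral[OF int]])
    show "finite {a, b}" by simp
    show "speed D g t = hyperbolic_density D (g t) * norm (g' t)" if "t \<in> {a..b} - {a, b}" for t
      using C1_piece_interior_derivative(2)[OF g'(2)[of t]] that ab by (auto simp: speed_def)
  qed
qed

lemma speed_integrable:
  assumes cont: "continuous_on D (hyperbolic_density D)" and g: "piecewise_C1_curve g" "path_image g \<subseteq> D"
  shows "speed D g integrable_on {0..1}"
proof (rule piecewise_C1_induct[OF g(1)])
  fix a b :: real assume ab: "0 \<le> a" "a < b" "b \<le> 1" "C1_piece g a b"
  obtain g' where g': "continuous_on {a..b} g'" "\<And>t. t \<in> {a..b} \<Longrightarrow> (g has_vector_derivative g' t) (at t within {a..b})"
    using ab(4) unfolding C1_piece_def by blast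
  show "speed D g integrable_on {a..b}"
    using C1_piece_speed(2)[OF cont _ ab(1-3) g'] g(2) unfolding path_image_def by blast
next
  fix a c b :: real
  assume "a < c" "c < b" "speed D g integrable_on {a..c}" "speed D g integrable_on {c..b}"
  then show "speed D g integrable_on {a..b}"
    by (intro Henstock_Kurzweil_Integration.integrable_combine[of a c b]) auto
qed

lemma hyperbolic_length_speed: "hyperbolic_length D g = integral {0..1} (speed D g)"
  by (simp add: hyperbolic_length_def speed_def[abs_def])

lemma hyperbolic_length_nonneg:
  assumes "\<And>w. w \<in> D \<Longrightarrow> 0 \<le> hyperbolic_density D w" "path_image g \<subseteq> D"
  shows "0 \<le> hyperbolic_length D g"
proof (cases "speed D g integrable_on {0..1}")
  case True
  then show ?thesis unfolding hyperbolic_length_speed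
  proof (rule integral_nonneg)
    fix t :: real assume "t \<in> {0..1}"
    then have "g t \<in> D" using assms(2) by (auto simp: path_image_def)
    then show "0 \<le> speed D g t" using assms(1) by (simp add: speed_def)
  qed
next
  case False then show ?thesis unfolding hyperbolic_length_speed by (simp add: not_integrable_integral)
qed

text \<open>The function \<open>w \<mapsto> ln (|w|\<^sup>2 + K\<^sup>2) / 2\<close> has gradient of length at most \<open>1 / sqrt (|w|\<^sup>2 + K\<^sup>2)\<close>, hence at most
\<open>C\<close> times the density; its increase along a curve is bounded by integrating.\<close>
lemma hyperbolic_length_ge:
  fixes \<Phi> :: "complex \<Rightarrow> real"
  assumes cont: "continuous_on D (hyperbolic_density D)" and g: "piecewise_C1_curve g" "path_image g \<subseteq> D"
    and low: "\<And>w. w \<in> D \<Longrightarrow> 1 \<le> C * sqrt ((norm w)\<^sup>2 + K\<^sup>2) * hyperbolic_density D w" and K: "K > 0"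
  shows "ln ((norm (pathfinish g))\<^sup>2 + K\<^sup>2) / 2 - ln ((norm (pathstart g))\<^sup>2 + K\<^sup>2) / 2 \<le> C * hyperbolic_length D g"
proof -
  define h where "h t = ln ((norm (g t))\<^sup>2 + K\<^sup>2) / 2" for t
  have Kp: "x \<bullet> x + K\<^sup>2 > 0" for x :: complex using K by (intro add_nonneg_pos) auto
  have gD: "g ` {0..1} \<subseteq> D" using g(2) by (simp add: path_image_def)
  have "h 1 - h 0 \<le> C * integral {0..1} (speed D g) \<and> speed D g integrable_on {0..1}"
  proof (rule piecewise_C1_induct[OF g(1)])
    fix a b :: real assume ab: "0 \<le> a" "a < b" "b \<le> 1" "C1_piece g a b"
    obtain g' where g': "continuous_on {a..b} g'" "\<And>t. t \<in> {a..b} \<Longrightarrow> (g has_vector_derivative g' t) (at t within {a..b})"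
      using ab(4) unfolding C1_piece_def by blast
    define J where "J = (\<lambda>t. hyperbolic_density D (g t) * norm (g' t))"
    have J: "J integrable_on {a..b}" "(speed D g has_integral (integral {a..b} J)) {a..b}"
      using C1_piece_speed[OF cont gD ab(1-3) g'] by (auto simp: J_def)
    define h' where "h' t = (g t \<bullet> g' t) / (g t \<bullet> g t + K\<^sup>2)" for t
    have "(h has_vector_derivative h' t) (at t within {a..b})" if t: "t \<in> {a..b}" for t
    proof -
      have "((\<lambda>t. g t \<bullet> g t) has_vector_derivative (g t \<bullet> g' t + g' t \<bullet> g t)) (at t within {a..b})"
        by (rule bounded_bilinear.has_vector_derivative[OF bounded_bilinear_inner g'(2)[OF t] g'(2)[OF t]])
      then have 1: "((\<lambda>t. g t \<bullet> g t) has_real_derivative (g t \<bullet> g' t + g' t \<bullet> g t)) (at t within {a..b})"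
        by (simp add: has_real_derivative_iff_has_vector_derivative)
      have "((\<lambda>t. ln (g t \<bullet> g t + K\<^sup>2) / 2) has_real_derivative h' t) (at t within {a..b})"
        unfolding h'_def using Kp[of "g t"]
        by (auto intro!: derivative_eq_intros 1 simp: inner_commute divide_simps)
      then show ?thesis
        unfolding h_def[abs_def] by (simp add: has_real_derivative_iff_has_vector_derivative power2_norm_eq_inner)
    qed
    then have ftc: "(h' has_integral (h b - h a)) {a..b}"
      using ab by (intro fundamental_theorem_of_calculus) auto
    have "h b - h a \<le> C * integral {a..b} J"
    proof (rule has_integral_le[OF ftc])
      show "((\<lambda>t. C * J t) has_integral C * integral {a..b} J) {a..b}"
        using has_integral_mult_right[OF integrable_integral[OF J(1)]] .
      fix t assume t: "t \<in> {a..b}"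
      define x where "x = norm (g t)"
      define q where "q = sqrt (x\<^sup>2 + K\<^sup>2)"
      have q: "q > 0" "q\<^sup>2 = x\<^sup>2 + K\<^sup>2" "x \<le> q"
        using K by (auto simp: q_def x_def intro: add_nonneg_pos real_le_rsqrt)
      have "g t \<in> D" using t ab gD by auto
      then have lo: "1 \<le> C * q * hyperbolic_density D (g t)" using low by (simp add: q_def x_def)
      have "g t \<bullet> g' t \<le> x * norm (g' t)" unfolding x_def by (rule norm_cauchy_schwarz)
      also have "\<dots> \<le> q * norm (g' t)" using q by (intro mult_right_mono) auto
      finally have "h' t \<le> q * norm (g' t) / q\<^sup>2"
        unfolding h'_def q(2) x_def power2_norm_eq_inner[symmetric] by (intro divide_right_mono) auto
      also have "\<dots> = 1 / q * norm (g' t)" unfolding power2_eq_square using q(1) by simp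
      also have "\<dots> \<le> (C * hyperbolic_density D (g t)) * norm (g' t)"
        using lo q(1) by (intro mult_right_mono) (simp_all add: divide_simps mult_ac)
      finally show "h' t \<le> C * J t" by (simp add: J_def mult_ac)
    qed
    then show "h b - h a \<le> C * integral {a..b} (speed D g) \<and> speed D g integrable_on {a..b}"
      using J(2) by (auto simp: integral_unique)
  next
    fix a c b :: real
    assume *: "a < c" "c < b" "h c - h a \<le> C * integral {a..c} (speed D g) \<and> speed D g integrable_on {a..c}"
      "h b - h c \<le> C * integral {c..b} (speed D g) \<and> speed D g integrable_on {c..b}"
    then have int: "speed D g integrable_on {a..b}"
      by (intro Henstock_Kurzweil_Integration.integrable_combine[of a c b]) auto
    have "integral {a..c} (speed D g) + integral {c..b} (speed D g) = integral {a..b} (speed D g)"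
      using * int by (intro Henstock_Kurzweil_Integration.integral_combine) auto
    then have "C * integral {a..b} (speed D g) = C * integral {a..c} (speed D g) + C * integral {c..b} (speed D g)"
      by (simp add: distrib_left[symmetric])
    then show "h b - h a \<le> C * integral {a..b} (speed D g) \<and> speed D g integrable_on {a..b}"
      using * int by linarith
  qed
  then show ?thesis by (simp add: h_def hyperbolic_length_speed pathstart_def pathfinish_def)
qed

lemma piecewise_C1_differentiable:
  assumes "piecewise_C1_curve g"
  obtains F where "finite F" "\<And>t. t \<in> {0..1} - F \<Longrightarrow> (g has_vector_derivative vector_derivative g (at t)) (at t)"
proof -
  have "\<exists>F. finite F \<and> (\<forall>t\<in>{0..1} - F. (g has_vector_derivative vector_derivative g (at t)) (at t))"
  proof (rule piecewise_C1_induct[OF assms])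
    fix a b :: real assume ab: "0 \<le> a" "a < b" "b \<le> 1" "C1_piece g a b"
    obtain g' where g': "\<And>t. t \<in> {a..b} \<Longrightarrow> (g has_vector_derivative g' t) (at t within {a..b})"
      using ab(4) unfolding C1_piece_def by blast
    have "(g has_vector_derivative vector_derivative g (at t)) (at t)" if "t \<in> {a..b} - {a, b}" for t
      using C1_piece_interior_derivative(1)[OF g'[of t]] that ab vector_derivative_at by fastforce
    then show "\<exists>F. finite F \<and> (\<forall>t\<in>{a..b} - F. (g has_vector_derivative vector_derivative g (at t)) (at t))"
      by (intro exI[of _ "{a, b}"]) auto
  next
    fix a c b :: real
    assume "a < c" "c < b" "\<exists>F. finite F \<and> (\<forall>t\<in>{a..c} - F. (g has_vector_derivative vector_derivative g (at t)) (at t))"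
      "\<exists>F. finite F \<and> (\<forall>t\<in>{c..b} - F. (g has_vector_derivative vector_derivative g (at t)) (at t))"
    then obtain F1 F2 where "finite F1" "\<forall>t\<in>{a..c} - F1. (g has_vector_derivative vector_derivative g (at t)) (at t)"
       "finite F2" "\<forall>t\<in>{c..b} - F2. (g has_vector_derivative vector_derivative g (at t)) (at t)" by blast
    then show "\<exists>F. finite F \<and> (\<forall>t\<in>{a..b} - F. (g has_vector_derivative vector_derivative g (at t)) (at t))"
      by (intro exI[of _ "F1 \<union> F2"] conjI ballI) (simp, metis DiffD1 DiffD2 DiffI UnI1 UnI2 atLeastAtMost_iff linorder_le_cases)
  qed
  then show ?thesis using that by blast
qed

lemma C1_piece_affine:
  assumes g: "C1_piece g (m * a + c) (m * b + c)" and m: "m > 0" and ab: "a < b"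
    and f: "\<And>t. t \<in> {a..b} \<Longrightarrow> f t = g (m * t + c)"
  shows "C1_piece f a b"
proof -
  obtain g' where g': "continuous_on {m * a + c..m * b + c} g'"
    "\<And>t. t \<in> {m * a + c..m * b + c} \<Longrightarrow> (g has_vector_derivative g' t) (at t within {m * a + c..m * b + c})"
    using g unfolding C1_piece_def by blast
  have im: "(\<lambda>t. m * t + c) ` {a..b} = {m * a + c..m * b + c}"
    using image_affinity_atLeastAtMost[of m c a b] m ab by auto
  show ?thesis
    unfolding C1_piece_def
  proof (intro exI[of _ "\<lambda>t. m *\<^sub>R g' (m * t + c)"] conjI ballI)
    show "continuous_on {a..b} (\<lambda>t. m *\<^sub>R g' (m * t + c))"
      by (intro continuous_intros continuous_on_compose2[OF g'(1)]) (use im in auto)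
    fix t assume t: "t \<in> {a..b}"
    then have t': "m * t + c \<in> {m * a + c..m * b + c}" using im by blast
    have "((\<lambda>t. m * t + c) has_vector_derivative m) (at t within {a..b})"
      by (auto intro!: derivative_eq_intros)
    then have "((g \<circ> (\<lambda>t. m * t + c)) has_vector_derivative m *\<^sub>R g' (m * t + c)) (at t within {a..b})"
      by (rule vector_diff_chain_within) (use g'(2)[OF t'] im in simp)
    then show "(f has_vector_derivative m *\<^sub>R g' (m * t + c)) (at t within {a..b})"
      by (rule has_vector_derivative_transform[OF t, rotated]) (simp add: f)
  qed
qed

lemma piecewise_C1_join:
  assumes g1: "piecewise_C1_curve g1" and g2: "piecewise_C1_curve g2" and e: "pathfinish g1 = pathstart g2"
  shows "piecewise_C1_curve (g1 +++ g2)"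
proof -
  obtain S1 where S1: "finite S1" "{0, 1} \<subseteq> S1" "S1 \<subseteq> {0..1}"
    "\<And>a b. \<lbrakk>a \<in> S1; b \<in> S1; a < b; {a<..<b} \<inter> S1 = {}\<rbrakk> \<Longrightarrow> C1_piece g1 a b"
    by (rule piecewise_C1_curveE[OF g1]) (rule that; assumption)
  obtain S2 where S2: "finite S2" "{0, 1} \<subseteq> S2" "S2 \<subseteq> {0..1}"
    "\<And>a b. \<lbrakk>a \<in> S2; b \<in> S2; a < b; {a<..<b} \<inter> S2 = {}\<rbrakk> \<Longrightarrow> C1_piece g2 a b"
    by (rule piecewise_C1_curveE[OF g2]) (rule that; assumption)
  define S where "S = {x. 2 * x \<in> S1} \<union> {x. 2 * x - 1 \<in> S2}"
  have "finite S"
  proof -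
    have "S = (*) 2 -` S1 \<union> (\<lambda>x. 2 * x - 1) -` S2" by (auto simp: S_def)
    then show ?thesis using S1(1) S2(1) by (auto intro!: finite_vimageI inj_onI)
  qed
  moreover have "{0, 1} \<subseteq> S" using S1(2) S2(2) by (auto simp: S_def)
  moreover have "S \<subseteq> {0..1}" using S1(3) S2(3) by (force simp: S_def)
  moreover have "C1_piece (g1 +++ g2) a b" if ab: "a \<in> S" "b \<in> S" "a < b" "{a<..<b} \<inter> S = {}" for a b
  proof -
    have half: "1/2 \<in> S" using S1(2) by (simp add: S_def)
    have lo: "2 * x \<in> S1" if "x \<in> S" "x \<le> 1/2" for x
    proof (cases "2 * x \<in> S1")
      case False
      then have "2 * x - 1 \<in> S2" using that(1) by (simp add: S_def)
      then have "2 * x = 1" using S2(3) that(2) by force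
      then show ?thesis using S1(2) by (simp only:) simp
    qed simp
    have hi: "2 * x - 1 \<in> S2" if "x \<in> S" "x \<ge> 1/2" for x
    proof (cases "2 * x - 1 \<in> S2")
      case False
      then have "2 * x \<in> S1" using that(1) by (simp add: S_def)
      then have "2 * x - 1 = 0" using S1(3) that(2) by force
      then show ?thesis using S2(2) by (simp only:) simp
    qed simp
    have "1/2 \<notin> {a<..<b}" using half ab(4) by blast
    then consider "b \<le> 1/2" | "a \<ge> 1/2" by (auto simp: not_less)
    then show ?thesis
    proof cases
      case 1
      have "{2 * a<..<2 * b} \<inter> S1 = {}"
      proof (rule ccontr)
        assume "{2 * a<..<2 * b} \<inter> S1 \<noteq> {}"
        then obtain x where "x \<in> S1" "2 * a < x" "x < 2 * b" by auto
        then have "x / 2 \<in> {a<..<b} \<inter> S" by (auto simp: S_def)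
        then show False using ab(4) by blast
      qed
      then have "C1_piece g1 (2 * a + 0) (2 * b + 0)" using S1(4)[of "2 * a" "2 * b"] lo ab 1 by auto
      then show ?thesis by (rule C1_piece_affine) (use ab 1 in \<open>auto simp: joinpaths_def\<close>)
    next
      case 2
      have "{2 * a - 1<..<2 * b - 1} \<inter> S2 = {}"
      proof (rule ccontr)
        assume "{2 * a - 1<..<2 * b - 1} \<inter> S2 \<noteq> {}"
        then obtain x where "x \<in> S2" "2 * a - 1 < x" "x < 2 * b - 1" by auto
        moreover have "2 * ((x + 1) / 2) - 1 = x" by (simp add: field_simps)
        ultimately have "(x + 1) / 2 \<in> {a<..<b} \<inter> S" unfolding S_def by fastforce
        then show False using ab(4) by blast
      qed
      then have piece: "C1_piece g2 (2 * a + -1) (2 * b + -1)" using S2(4)[of "2 * a - 1" "2 * b - 1"] hi ab 2 by auto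
      have "(g1 +++ g2) t = g2 (2 * t + - 1)" if "t \<in> {a..b}" for t
      proof (cases "t = 1/2")
        case True
        then have t: "2 * t = 1" "2 * t + - 1 = 0" by simp_all
        have "(g1 +++ g2) t = g1 (2 * t)" using True by (simp add: joinpaths_def)
        then show ?thesis using e unfolding t by (simp add: pathfinish_def pathstart_def)
      next
        case False then show ?thesis using that 2 by (simp add: joinpaths_def)
      qed
      then show ?thesis by (intro C1_piece_affine[OF piece _ ab(3)]) simp_all
    qed
  qed
  moreover have "path (g1 +++ g2)" using g1 g2 e by (simp add: piecewise_C1_curve_def)
  ultimately show ?thesis unfolding piecewise_C1_curve_iff by (intro conjI exI[of _ S]) simp_all
qed

text \<open>Each half of the joined curve is a reparametrised piece, and the factor \<open>2\<close> from the chain rule cancels the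
one from the substitution. Both hold away from the finitely many points where the pieces are not
differentiable.\<close>
lemma hyperbolic_length_join:
  assumes cont: "continuous_on D (hyperbolic_density D)"
    and g1: "piecewise_C1_curve g1" "path_image g1 \<subseteq> D" and g2: "piecewise_C1_curve g2" "path_image g2 \<subseteq> D"
  shows "hyperbolic_length D (g1 +++ g2) = hyperbolic_length D g1 + hyperbolic_length D g2"
proof -
  obtain F1 where F1: "finite F1" "\<And>t. t \<in> {0..1} - F1 \<Longrightarrow> (g1 has_vector_derivative vector_derivative g1 (at t)) (at t)"
    using piecewise_C1_differentiable[OF g1(1)] by metis
  obtain F2 where F2: "finite F2" "\<And>t. t \<in> {0..1} - F2 \<Longrightarrow> (g2 has_vector_derivative vector_derivative g2 (at t)) (at t)"
    using piecewise_C1_differentiable[OF g2(1)] by metis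
  define L1 L2 where "L1 = hyperbolic_length D g1" and "L2 = hyperbolic_length D g2"
  have 1: "(speed D g1 has_integral L1) {0..1}" and 2: "(speed D g2 has_integral L2) {0..1}"
    unfolding L1_def L2_def hyperbolic_length_speed
    using speed_integrable[OF cont g1] speed_integrable[OF cont g2] by (auto intro: integrable_integral)
  have i1: "((\<lambda>x. 2 * speed D g1 (2 * x)) has_integral L1) {0..1/2}"
   and i2: "((\<lambda>x. 2 * speed D g2 (2 * x - 1)) has_integral L2) {1/2..1}"
    using has_integral_affinity01 [OF 1, where m= 2 and c=0, THEN has_integral_cmul [where c=2]]
          has_integral_affinity01 [OF 2, where m= 2 and c="-1", THEN has_integral_cmul [where c=2]]
    by (simp_all only: image_affinity_atLeastAtMost_div_diff, simp_all add: mult_ac)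
  have j1: "(speed D (g1 +++ g2) has_integral L1) {0..1/2}"
  proof (rule has_integral_spike_finite[OF _ _ i1])
    show "finite ({0, 1/2} \<union> (*) 2 -` F1)" using F1(1) by (auto intro!: finite_vimageI inj_onI)
    fix t :: real assume t: "t \<in> {0..1/2} - ({0, 1/2} \<union> (*) 2 -` F1)"
    then have d: "(g1 has_vector_derivative vector_derivative g1 (at (2 * t))) (at (2 * t))" using F1(2)[of "2 * t"] by auto
    have "((\<lambda>x. 2 * x) has_vector_derivative 2) (at t)" by (auto intro!: derivative_eq_intros)
    then have "((g1 \<circ> (\<lambda>x. 2 * x)) has_vector_derivative 2 *\<^sub>R vector_derivative g1 (at (2 * t))) (at t)"
      using d by (rule vector_diff_chain_at)
    then have "((g1 +++ g2) has_vector_derivative 2 *\<^sub>R vector_derivative g1 (at (2 * t))) (at t)"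
      by (rule has_vector_derivative_transform_within_open[of _ _ _ "{..<1/2}"]) (use t in \<open>auto simp: joinpaths_def\<close>)
    then have "vector_derivative (g1 +++ g2) (at t within {0..1}) = 2 *\<^sub>R vector_derivative g1 (at (2 * t))"
      by (rule vector_derivative_at_within_ivl) (use t in auto)
    moreover have "vector_derivative g1 (at (2 * t) within {0..1}) = vector_derivative g1 (at (2 * t))"
      using d by (rule vector_derivative_at_within_ivl) (use t in auto)
    ultimately show "speed D (g1 +++ g2) t = 2 * speed D g1 (2 * t)"
      using t by (simp add: speed_def joinpaths_def)
  qed
  have j2: "(speed D (g1 +++ g2) has_integral L2) {1/2..1}"
  proof (rule has_integral_spike_finite[OF _ _ i2])
    show "finite ({1, 1/2} \<union> (\<lambda>t. 2 * t - 1) -` F2)" using F2(1) by (auto intro!: finite_vimageI inj_onI)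
    fix t :: real assume t: "t \<in> {1/2..1} - ({1, 1/2} \<union> (\<lambda>t. 2 * t - 1) -` F2)"
    then have d: "(g2 has_vector_derivative vector_derivative g2 (at (2 * t - 1))) (at (2 * t - 1))" using F2(2)[of "2 * t - 1"] by auto
    have "((\<lambda>x. 2 * x - 1) has_vector_derivative 2) (at t)" by (auto intro!: derivative_eq_intros)
    then have "((g2 \<circ> (\<lambda>x. 2 * x - 1)) has_vector_derivative 2 *\<^sub>R vector_derivative g2 (at (2 * t - 1))) (at t)"
      using d by (rule vector_diff_chain_at)
    then have "((g1 +++ g2) has_vector_derivative 2 *\<^sub>R vector_derivative g2 (at (2 * t - 1))) (at t)"
      by (rule has_vector_derivative_transform_within_open[of _ _ _ "{1/2<..}"]) (use t in \<open>auto simp: joinpaths_def\<close>)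
    then have "vector_derivative (g1 +++ g2) (at t within {0..1}) = 2 *\<^sub>R vector_derivative g2 (at (2 * t - 1))"
      by (rule vector_derivative_at_within_ivl) (use t in auto)
    moreover have "vector_derivative g2 (at (2 * t - 1) within {0..1}) = vector_derivative g2 (at (2 * t - 1))"
      using d by (rule vector_derivative_at_within_ivl) (use t in auto)
    ultimately show "speed D (g1 +++ g2) t = 2 * speed D g2 (2 * t - 1)"
      using t by (simp add: speed_def joinpaths_def)
  qed
  have "(speed D (g1 +++ g2) has_integral (L1 + L2)) {0..1}"
    by (rule Henstock_Kurzweil_Integration.has_integral_combine[OF _ _ j1 j2]) auto
  then show ?thesis unfolding hyperbolic_length_speed[of D "g1 +++ g2"] L1_def L2_def by (rule integral_unique)
qed

lemma piecewise_C1_linepath: "piecewise_C1_curve (linepath a b)"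
  unfolding piecewise_C1_curve_iff C1_piece_def
proof (intro conjI exI[of _ "{0, 1}"] ballI impI exI[of _ "\<lambda>_. b - a"])
  fix s t u :: real assume "u \<in> {s..t}"
  show "(linepath a b has_vector_derivative b - a) (at u within {s..t})"
    by (rule has_vector_derivative_linepath_within)
qed auto

lemma speed_linepath:
  assumes "t \<in> {0..1}"
  shows "speed D (linepath a b) t = hyperbolic_density D (linepath a b t) * norm (b - a)"
  using vector_derivative_linepath_within[of t a b] assms by (simp add: speed_def)

section \<open>The distance estimate\<close>

lemma hyperbolic_dist_le:
  assumes "\<And>w. w \<in> D \<Longrightarrow> 0 \<le> hyperbolic_density D w"
    and "piecewise_C1_curve g" "path_image g \<subseteq> D" "pathstart g = z" "pathfinish g = w"
  shows "hyperbolic_dist D z w \<le> hyperbolic_length D g"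
  unfolding hyperbolic_dist_def
proof (rule cInf_lower)
  show "bdd_below {hyperbolic_length D g |g. piecewise_C1_curve g \<and> path_image g \<subseteq> D \<and> pathstart g = z \<and> pathfinish g = w}"
    by (rule bdd_belowI[of _ 0]) (use hyperbolic_length_nonneg[OF assms(1)] in auto)
qed (use assms in auto)

lemma Omega_N_nonreal: "Im w \<noteq> 0 \<Longrightarrow> w \<in> Omega_N"
  by (auto simp: Omega_N_iff)

text \<open>Far to the right the slit plane bound is \<open>1 / (4 * x)\<close> up to a shift of \<open>x\<close>, and the shift changes it only by
\<open>O(1/x\<^sup>2)\<close>; on the remaining compact part the density is bounded. The error term is integrable, so it
contributes only to the additive constant.\<close>
lemma density_along_horizontal_ray:
  assumes u: "Im u \<noteq> 0"
  obtains C where "C \<ge> 0"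
    "\<And>x. x \<ge> 0 \<Longrightarrow> hyperbolic_density Omega_N (u + of_real x) \<le> 1 / (4 * (1 + x)) + C / (1 + x)\<^sup>2"
proof -
  obtain p where p: "holomorphic_universal_covering p Omega_N" using universal_covering_Omega_N by blast
  have inO: "u + of_real x \<in> Omega_N" for x using u by (intro Omega_N_nonreal) simp
  define T where "T = \<bar>Re u\<bar>"
  have T: "T \<ge> 0" "Re u \<ge> - T" by (auto simp: T_def)
  have "continuous_on {0..T} (\<lambda>x. hyperbolic_density Omega_N (u + of_real x))"
    by (rule continuous_on_compose2[OF hyperbolic_density_continuous[OF p open_Omega_N]])
       (use inO in \<open>auto intro!: continuous_intros\<close>)
  then have "compact ((\<lambda>x. hyperbolic_density Omega_N (u + of_real x)) ` {0..T})"
    by (rule compact_continuous_image) simp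
  then obtain M where M: "M > 0" "\<And>x. x \<in> {0..T} \<Longrightarrow> norm (hyperbolic_density Omega_N (u + of_real x)) \<le> M"
    using compact_imp_bounded bounded_pos by (metis (no_types, lifting) imageI)
  \<comment> \<open>the first summand dominates the density for \<open>x \<le> T\<close>, the second one the shift by \<open>T\<close> for larger \<open>x\<close>\<close>
  define C where "C = M * (1 + T)\<^sup>2 + T * (1 + T)"
  have C0: "M * (1 + T)\<^sup>2 \<ge> 0" "T * (1 + T) \<ge> 0" using M(1) T(1) by auto
  show ?thesis
  proof
    show "C \<ge> 0" using C0 by (simp add: C_def)
    fix x :: real assume x: "x \<ge> 0"
    have pos: "(1 + x)\<^sup>2 > 0" using x by simp
    show "hyperbolic_density Omega_N (u + of_real x) \<le> 1 / (4 * (1 + x)) + C / (1 + x)\<^sup>2"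
    proof (cases "x \<le> T")
      case True
      have "hyperbolic_density Omega_N (u + of_real x) \<le> M" using M(2)[of x] True x by simp
      also have "\<dots> \<le> M * (1 + T)\<^sup>2 / (1 + x)\<^sup>2"
        using pos M(1) True x by (simp add: pos_le_divide_eq power_mono)
      also have "\<dots> \<le> C / (1 + x)\<^sup>2" using C0 by (intro divide_right_mono) (auto simp: C_def)
      also have "\<dots> \<le> 1 / (4 * (1 + x)) + C / (1 + x)\<^sup>2" using x by simp
      finally show ?thesis .
    next
      case False
      define y where "y = 1 + x - T"
      have y: "y > 0" "y \<ge> 1" using False by (auto simp: y_def)
      have "hyperbolic_density Omega_N (u + of_real x) \<le> 1 / (4 * (Re (u + of_real x) + 1))"
        using T False by (intro hyperbolic_density_Omega_N_le) simp
      also have "\<dots> \<le> 1 / (4 * y)" using T(2) y(1) by (intro divide_left_mono) (auto simp: y_def)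
      also have "1 / (4 * y) - 1 / (4 * (1 + x)) = T / (4 * y * (1 + x))"
      proof -
        have "T / (4 * y * (1 + x)) = ((1 + x) - y) / (4 * y * (1 + x))" by (simp add: y_def)
        also have "\<dots> = 1 / (4 * y) - 1 / (4 * (1 + x))" using y(1) x by (simp add: diff_divide_distrib)
        finally show ?thesis by simp
      qed
      then have "1 / (4 * y) = 1 / (4 * (1 + x)) + T / (4 * y * (1 + x))" by simp
      also have "T / (4 * y * (1 + x)) \<le> T * (1 + T) / (1 + x)\<^sup>2"
      proof -
        have "(1 + T) * y - (1 + x) = T * (x - T)" by (simp add: y_def algebra_simps)
        also have "\<dots> \<ge> 0" using False T by simp
        finally have "1 + x \<le> 4 * ((1 + T) * y)" using T y by (smt (verit) mult_nonneg_nonneg)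
        then have "1 / (4 * y) \<le> (1 + T) / (1 + x)" using y(1) x by (simp add: divide_simps mult_ac)
        then have "T / (1 + x) * (1 / (4 * y)) \<le> T / (1 + x) * ((1 + T) / (1 + x))"
          using T(1) x by (intro mult_left_mono) auto
        then show ?thesis by (simp add: power2_eq_square mult_ac)
      qed
      also have "\<dots> \<le> C / (1 + x)\<^sup>2" using C0 by (intro divide_right_mono) (auto simp: C_def)
      finally show ?thesis by simp
    qed
  qed
qed

lemma horizontal_length_le:
  fixes n :: nat
  assumes u: "Im u \<noteq> 0" and n: "n \<ge> 1" and C: "C \<ge> 0"
    "\<And>x. x \<ge> 0 \<Longrightarrow> hyperbolic_density Omega_N (u + of_real x) \<le> 1 / (4 * (1 + x)) + C / (1 + x)\<^sup>2"
  shows "hyperbolic_length Omega_N (linepath u (u + of_nat n)) \<le> 1 / 4 * ln (real n) + ln 2 / 4 + C"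
proof -
  obtain p where p: "holomorphic_universal_covering p Omega_N" using universal_covering_Omega_N by blast
  define l where "l = linepath u (u + of_nat n)"
  have l: "l t = u + of_real (real n * t)" for t by (simp add: l_def linepath_def algebra_simps scaleR_conv_of_real)
  have "path_image l \<subseteq> Omega_N" using u by (auto simp: path_image_def l intro!: Omega_N_nonreal)
  then have int: "speed Omega_N l integrable_on {0..1}"
    using speed_integrable[OF hyperbolic_density_continuous[OF p open_Omega_N]] piecewise_C1_linepath by (simp add: l_def)
  define F where "F t = ln (1 + real n * t) / 4 - C / (1 + real n * t)" for t
  define f where "f t = (1 / (4 * (1 + real n * t)) + C / (1 + real n * t)\<^sup>2) * real n" for t
  have "(f has_integral (F 1 - F 0)) {0..1}"
  proof (rule fundamental_theorem_of_calculus)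
    fix t :: real assume "t \<in> {0..1}"
    then have pos: "1 + real n * t > 0" by (intro add_pos_nonneg) auto
    define v where "v = 1 + real n * t"
    have v: "v > 0" using pos by (simp add: v_def)
    have dv: "((\<lambda>t. 1 + real n * t) has_real_derivative real n) (at t within {0..1})"
      by (auto intro!: derivative_eq_intros)
    have "(F has_real_derivative (1 / v * real n / 4 - (0 * v - C * real n) / (v * v))) (at t within {0..1})"
      unfolding F_def[abs_def] v_def
      by (intro DERIV_diff DERIV_cdivide DERIV_divide DERIV_const DERIV_chain2[OF DERIV_ln_divide] dv) (use pos in auto)
    moreover have "1 / v * real n / 4 - (0 * v - C * real n) / (v * v) = f t"
      using v by (simp add: f_def v_def[symmetric] power2_eq_square distrib_right)
    ultimately have "(F has_real_derivative f t) (at t within {0..1})" by simp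
    then show "(F has_vector_derivative f t) (at t within {0..1})"
      by (simp add: has_real_derivative_iff_has_vector_derivative)
  qed simp
  then have "integral {0..1} (speed Omega_N l) \<le> F 1 - F 0"
  proof (rule has_integral_le[OF integrable_integral[OF int]])
    fix t :: real assume t: "t \<in> {0..1}"
    have "speed Omega_N l t = hyperbolic_density Omega_N (u + of_real (real n * t)) * real n"
      using speed_linepath[OF t, of Omega_N u "u + of_nat n"] by (simp add: l_def[symmetric] l)
    also have "\<dots> \<le> f t" unfolding f_def using C(2)[of "real n * t"] t by (intro mult_right_mono) auto
    finally show "speed Omega_N l t \<le> f t" .
  qed
  also have "F 1 - F 0 \<le> ln (1 + real n) / 4 + C" using C(1) by (simp add: F_def)
  also have "ln (1 + real n) \<le> ln (2 * real n)" using n by simp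
  also have "ln (2 * real n) = ln 2 + ln (real n)" using n by (simp add: ln_mult)
  finally show ?thesis by (simp add: hyperbolic_length_speed l_def add_divide_distrib)
qed

theorem proposition8p4:
  fixes z :: complex
  assumes "z \<in> Omega_N"
  shows "\<exists>c2::real. c2 > 0 \<and>
    (\<forall>\<epsilon>::real. \<epsilon> > 0 \<longrightarrow> (\<exists>c1::real. \<forall>n::nat. n \<ge> 1 \<longrightarrow>
       1 / (4 + \<epsilon>) * ln (real n) + c1 \<le> hyperbolic_dist Omega_N z (z + of_nat n) \<and>
       hyperbolic_dist Omega_N z (z + of_nat n) \<le> 1 / 4 * ln (real n) + c2))"
proof -
  obtain p where p: "holomorphic_universal_covering p Omega_N" using universal_covering_Omega_N by blast
  note cont = hyperbolic_density_continuous[OF p open_Omega_N]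
  have dnn: "0 \<le> hyperbolic_density Omega_N w" if "w \<in> Omega_N" for w
    using hyperbolic_density_pos[OF p that] by simp
  \<comment> \<open>moving vertically by one unit, away from the real axis, makes the horizontal segment avoid the punctures\<close>
  define \<sigma> :: real where "\<sigma> = (if Im z \<ge> 0 then 1 else -1)"
  define u where "u = z + of_real \<sigma> * \<i>"
  have Imu: "Im u \<noteq> 0" by (simp add: u_def \<sigma>_def)
  have vert: "linepath z u t \<in> Omega_N" "linepath u z t \<in> Omega_N" if t: "t \<in> {0..1}" for t
  proof -
    have *: "linepath z u s \<in> Omega_N" if s: "s \<in> {0..1}" for s
    proof (cases "s = 0")
      case True then show ?thesis using assms by (simp add: linepath_def)
    next
      case False
      have "Im (linepath z u s) = Im z + s * \<sigma>" by (simp add: linepath_def u_def algebra_simps)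
      moreover have "Im z + s * \<sigma> \<noteq> 0" using False s by (auto simp: \<sigma>_def)
      ultimately show ?thesis by (intro Omega_N_nonreal) simp
    qed
    show "linepath z u t \<in> Omega_N" using *[OF t] .
    have "linepath u z t = linepath z u (1 - t)" by (simp add: linepath_def)
    then show "linepath u z t \<in> Omega_N" using *[of "1 - t"] t by simp
  qed
  obtain C where C: "C \<ge> 0"
    "\<And>x. x \<ge> 0 \<Longrightarrow> hyperbolic_density Omega_N (u + of_real x) \<le> 1 / (4 * (1 + x)) + C / (1 + x)\<^sup>2"
    using density_along_horizontal_ray[OF Imu] by metis
  define A B where "A = hyperbolic_length Omega_N (linepath z u)" and "B = hyperbolic_length Omega_N (linepath u z)"
  have imA: "path_image (linepath z u) \<subseteq> Omega_N" and imB: "path_image (linepath u z) \<subseteq> Omega_N"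
    using vert by (force simp: path_image_def simp del: path_image_linepath)+
  have A0: "A \<ge> 0" "B \<ge> 0" unfolding A_def B_def using hyperbolic_length_nonneg[OF dnn] imA imB by auto
  define c2 where "c2 = A + B + C + ln 2 / 4"
  have c2: "c2 > 0" using A0 C(1) by (simp add: c2_def add_nonneg_pos)
  \<comment> \<open>the third segment is a translate of the reversed first one, so its length is bounded independently of \<open>n\<close>\<close>
  define \<gamma> where "\<gamma> n = linepath z u +++ (linepath u (u + of_nat n) +++ linepath (u + of_nat n) (z + of_nat n))" for n :: nat
  have \<gamma>: "piecewise_C1_curve (\<gamma> n)" "path_image (\<gamma> n) \<subseteq> Omega_N" "pathstart (\<gamma> n) = z" "pathfinish (\<gamma> n) = z + of_nat n"
    and len: "n \<ge> 1 \<Longrightarrow> hyperbolic_length Omega_N (\<gamma> n) \<le> 1 / 4 * ln (real n) + c2" for n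
  proof -
    define l1 l2 l3 where "l1 = linepath z u" and "l2 = linepath u (u + of_nat n)"
      and "l3 = linepath (u + of_nat n) (z + of_nat n)"
    have pw: "piecewise_C1_curve l1" "piecewise_C1_curve l2" "piecewise_C1_curve l3"
      by (simp_all add: l1_def l2_def l3_def piecewise_C1_linepath)
    have ends: "pathfinish l1 = pathstart l2" "pathfinish l2 = pathstart l3" "pathfinish l1 = pathstart (l2 +++ l3)"
      by (simp_all add: l1_def l2_def l3_def)
    have l3: "l3 t = linepath u z t + of_nat n" for t
      by (simp add: l3_def linepath_def algebra_simps scaleR_conv_of_real)
    have im1: "path_image l1 \<subseteq> Omega_N" using imA by (simp add: l1_def)
    have im2: "path_image l2 \<subseteq> Omega_N" using Imu
      by (auto simp: path_image_def l2_def linepath_def algebra_simps simp del: path_image_linepath intro!: Omega_N_nonreal)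
    have im3: "path_image l3 \<subseteq> Omega_N"
      using vert(2) by (auto simp: path_image_def l3 intro!: Omega_N_add)
    have im23: "path_image (l2 +++ l3) \<subseteq> Omega_N" using im2 im3 path_image_join_subset by blast
    have pw23: "piecewise_C1_curve (l2 +++ l3)" using piecewise_C1_join pw ends by blast
    have \<gamma>eq: "\<gamma> n = l1 +++ (l2 +++ l3)" by (simp add: \<gamma>_def l1_def l2_def l3_def)
    show "piecewise_C1_curve (\<gamma> n)" unfolding \<gamma>eq by (rule piecewise_C1_join[OF pw(1) pw23 ends(3)])
    show "path_image (\<gamma> n) \<subseteq> Omega_N" unfolding \<gamma>eq using im1 im23 path_image_join_subset by blast
    show "pathstart (\<gamma> n) = z" "pathfinish (\<gamma> n) = z + of_nat n" by (simp_all add: \<gamma>_def)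
    assume n: "n \<ge> 1"
    have "hyperbolic_length Omega_N l3 \<le> B"
      unfolding B_def hyperbolic_length_speed
    proof (rule integral_le[OF speed_integrable[OF cont pw(3) im3] speed_integrable[OF cont piecewise_C1_linepath imB]])
      fix t :: real assume t: "t \<in> {0..1}"
      have "speed Omega_N l3 t = hyperbolic_density Omega_N (linepath u z t + of_nat n) * norm (z - u)"
        unfolding l3_def speed_linepath[OF t] using l3[of t] by (simp add: l3_def)
      also have "\<dots> \<le> hyperbolic_density Omega_N (linepath u z t) * norm (z - u)"
        using hyperbolic_density_translate[OF vert(2)[OF t]] by (intro mult_right_mono) auto
      finally show "speed Omega_N l3 t \<le> speed Omega_N (linepath u z) t" by (simp add: speed_linepath[OF t])
    qed
    moreover have "hyperbolic_length Omega_N l2 \<le> 1 / 4 * ln (real n) + ln 2 / 4 + C"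
      unfolding l2_def by (rule horizontal_length_le[OF Imu n C])
    moreover have "hyperbolic_length Omega_N (\<gamma> n) = A + (hyperbolic_length Omega_N l2 + hyperbolic_length Omega_N l3)"
      unfolding \<gamma>eq A_def hyperbolic_length_join[OF cont pw(1) im1 pw23 im23]
        hyperbolic_length_join[OF cont pw(2) im2 pw(3) im3] by (simp add: l1_def)
    ultimately show "hyperbolic_length Omega_N (\<gamma> n) \<le> 1 / 4 * ln (real n) + c2" by (simp add: c2_def)
  qed
  have "\<exists>c1::real. \<forall>n::nat. n \<ge> 1 \<longrightarrow>
       1 / (4 + \<epsilon>) * ln (real n) + c1 \<le> hyperbolic_dist Omega_N z (z + of_nat n) \<and>
       hyperbolic_dist Omega_N z (z + of_nat n) \<le> 1 / 4 * ln (real n) + c2" if \<epsilon>: "\<epsilon> > 0" for \<epsilon> :: real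
  proof -
    obtain K :: real where K: "K \<ge> 1"
      "\<And>w. w \<in> Omega_N \<Longrightarrow> 1 \<le> (4 + \<epsilon>) * sqrt ((norm w)\<^sup>2 + K\<^sup>2) * hyperbolic_density Omega_N w"
      using hyperbolic_density_Omega_N_ge[OF \<epsilon>] by metis
    define Q where "Q = ln (2 * (1 + (norm z)\<^sup>2)) + ln ((norm z)\<^sup>2 + K\<^sup>2)"
    define c1 where "c1 = - Q / (2 * (4 + \<epsilon>))"
    have "1 / (4 + \<epsilon>) * ln (real n) + c1 \<le> hyperbolic_dist Omega_N z (z + of_nat n)" if n: "n \<ge> 1" for n :: nat
      unfolding hyperbolic_dist_def
    proof (rule cInf_greatest)
      show "{hyperbolic_length Omega_N g |g. piecewise_C1_curve g \<and> path_image g \<subseteq> Omega_N \<and> pathstart g = z \<and>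
          pathfinish g = z + of_nat n} \<noteq> {}" using \<gamma> by blast
      fix L assume "L \<in> {hyperbolic_length Omega_N g |g. piecewise_C1_curve g \<and> path_image g \<subseteq> Omega_N \<and> pathstart g = z \<and>
          pathfinish g = z + of_nat n}"
      then obtain g where g: "L = hyperbolic_length Omega_N g" "piecewise_C1_curve g" "path_image g \<subseteq> Omega_N"
        "pathstart g = z" "pathfinish g = z + of_nat n" by blast
      define a where "a = norm (z + of_nat n)"
      have "ln (a\<^sup>2 + K\<^sup>2) / 2 - ln ((norm z)\<^sup>2 + K\<^sup>2) / 2 \<le> (4 + \<epsilon>) * L"
        using hyperbolic_length_ge[OF cont g(2,3), of "4 + \<epsilon>" K] K g by (simp add: a_def)
      moreover have "2 * ln (real n) \<le> ln (2 * (1 + (norm z)\<^sup>2)) + ln (a\<^sup>2 + K\<^sup>2)"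
      proof -
        have K2: "1 \<le> K\<^sup>2" using K(1) by (simp add: one_le_power)
        have p1: "2 * (1 + (norm z)\<^sup>2) > 0" by (simp add: add_pos_nonneg)
        have p2: "a\<^sup>2 + K\<^sup>2 > 0" using K2 by (intro add_nonneg_pos) auto
        have "real n = norm ((z + of_nat n) - z)" by simp
        also have "\<dots> \<le> a + norm z" unfolding a_def by (rule norm_triangle_ineq4)
        finally have "(real n)\<^sup>2 \<le> (a + norm z)\<^sup>2" by (intro power_mono) auto
        also have "\<dots> \<le> 2 * a\<^sup>2 + 2 * (norm z)\<^sup>2"
          using zero_le_power2[of "a - norm z"] by (simp add: power2_eq_square algebra_simps)
        also have "\<dots> \<le> 2 * (1 + (norm z)\<^sup>2) * (a\<^sup>2 + K\<^sup>2)"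
        proof -
          have "(norm z)\<^sup>2 * 1 \<le> (norm z)\<^sup>2 * K\<^sup>2" using K2 by (intro mult_left_mono) auto
          moreover have "0 \<le> (norm z)\<^sup>2 * a\<^sup>2" "0 \<le> K\<^sup>2" by auto
          moreover have "2 * (1 + (norm z)\<^sup>2) * (a\<^sup>2 + K\<^sup>2)
              = 2 * a\<^sup>2 + 2 * K\<^sup>2 + 2 * ((norm z)\<^sup>2 * a\<^sup>2) + 2 * ((norm z)\<^sup>2 * K\<^sup>2)" by (simp add: algebra_simps)
          ultimately show ?thesis by linarith
        qed
        finally have "ln ((real n)\<^sup>2) \<le> ln (2 * (1 + (norm z)\<^sup>2) * (a\<^sup>2 + K\<^sup>2))"
          using n p1 p2 by (intro ln_mono) auto
        then show ?thesis unfolding ln_mult_pos[OF p1 p2] using n by (simp add: ln_realpow)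
      qed
      ultimately have "2 * ln (real n) - Q \<le> 2 * (4 + \<epsilon>) * L" unfolding Q_def by linarith
      then have "(2 * ln (real n) - Q) / (2 * (4 + \<epsilon>)) \<le> L" using \<epsilon> by (simp add: divide_le_eq mult_ac)
      moreover have "1 / (4 + \<epsilon>) * ln (real n) + c1 = (2 * ln (real n) - Q) / (2 * (4 + \<epsilon>))"
      proof -
        have "1 / N * l + - Q / (2 * N) = (2 * l - Q) / (2 * N)" if "N \<noteq> 0" for N l :: real
          using that by (simp add: diff_divide_distrib)
        from this[of "4 + \<epsilon>" "ln (real n)"] show ?thesis using \<epsilon> unfolding c1_def by linarith
      qed
      ultimately show "1 / (4 + \<epsilon>) * ln (real n) + c1 \<le> L" by simp
    qed
    moreover have "hyperbolic_dist Omega_N z (z + of_nat n) \<le> 1 / 4 * ln (real n) + c2" if "n \<ge> 1" for n :: nat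
      using hyperbolic_dist_le[OF dnn \<gamma>] len[OF that] by (meson order_trans)
    ultimately show ?thesis by blast
  qed
  then show ?thesis using c2 by blast
qed

end
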